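(* For every real $K>0$, the relation $\sqsubseteq_i^K$ of isometric embeddability on $X^K_{PMGp}=\operatorname{Subg}(\boldsymbol{D}_K)$ is a complete $\boldsymbol{\Sigma}^1_1$ quasi-order, i.e. every $\boldsymbol{\Sigma}^1_1$ quasi-order on a standard Borel space Borel reduces to $\sqsubseteq_i^K$.
   Context: For $K>0$, $\boldsymbol{D}_K$ is a fixed Polish metric group with a bi-invariant metric $d_K$ bounded by $K$ which contains a closed isometric copy of every separable group with a complete bi-invariant metric bounded by $K$ (such a group exists by a theorem of Doucha). $X^K_{PMGp}=\operatorname{Subg}(\boldsymbol{D}_K)$ is the standard Borel space (Effros Borel structure) of closed subgroups of $\boldsymbol{D}_K$, each carrying the restriction of $d_K$. For $\boldsymbol{H},\boldsymbol{H}'\in X^K_{PMGp}$, $\boldsymbol{H}\sqsubseteq_i^K\boldsymbol{H}'$ iff there is a group embedding of $\boldsymbol{H}$ into $\boldsymbol{H}'$ which is an isometry. A $\boldsymbol{\Sigma}^1_1$ quasi-order is a reflexive transitive relation that is an analytic subset of $X\times X$ for a standard Borel space $X$; $P$ on $X$ Borel reduces to $Q$ on $Y$ if there is a Borel $f\colon X\to Y$ with $x\mathrel{P}x'\iff f(x)\mathrel{Q}f(x')$. *)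

theory Defs
  imports "HOL-Analysis.Analysis" "HOL-Algebra.Group"
begin

definition polish_topology :: "'a topology \<Rightarrow> bool" where
  "polish_topology T \<longleftrightarrow> completely_metrizable_space T \<and> separable_space T"

text \<open>Measures are used only as carriers of their \<sigma>-algebras; measure values play no role.\<close>

definition standard_borel_space :: "'a measure \<Rightarrow> bool" where
  "standard_borel_space X \<longleftrightarrow>
     (\<exists>T. polish_topology T \<and> topspace T = space X \<and>
          sets X = sigma_sets (topspace T) {U. openin T U})"

text \<open>Analytic subsets of \<open>X\<close> are the projections of Borel subsets of
  \<open>X\<close> times the Baire space \<open>nat \<Rightarrow> nat\<close> (product topology, \<open>nat\<close> discrete).\<close>

definition analytic_subset :: "'a measure \<Rightarrow> 'a set \<Rightarrow> bool" where
  "analytic_subset X A \<longleftrightarrow>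
     (\<exists>B \<in> sets (X \<Otimes>\<^sub>M (borel :: (nat \<Rightarrow> nat) measure)). A = fst ` B)"

definition Sigma11_quasi_order :: "'a measure \<Rightarrow> ('a \<times> 'a) set \<Rightarrow> bool" where
  "Sigma11_quasi_order X R \<longleftrightarrow>
     standard_borel_space X \<and> preorder_on (space X) R \<and> analytic_subset (X \<Otimes>\<^sub>M X) R"

definition borel_reduces ::
    "'a measure \<Rightarrow> ('a \<times> 'a) set \<Rightarrow> 'b measure \<Rightarrow> ('b \<times> 'b) set \<Rightarrow> bool" where
  "borel_reduces X P Y Q \<longleftrightarrow>
     (\<exists>f \<in> measurable X Y. \<forall>x \<in> space X. \<forall>x' \<in> space X.
        (x, x') \<in> P \<longleftrightarrow> (f x, f x') \<in> Q)"

definition bi_invariant :: "'g monoid \<Rightarrow> ('g \<Rightarrow> 'g \<Rightarrow> real) \<Rightarrow> bool" where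
  "bi_invariant G d \<longleftrightarrow>
     (\<forall>x \<in> carrier G. \<forall>y \<in> carrier G. \<forall>z \<in> carrier G.
        d (z \<otimes>\<^bsub>G\<^esub> x) (z \<otimes>\<^bsub>G\<^esub> y) = d x y \<and> d (x \<otimes>\<^bsub>G\<^esub> z) (y \<otimes>\<^bsub>G\<^esub> z) = d x y)"

text \<open>Separable groups with a complete bi-invariant metric bounded by \<open>K\<close>. Continuity of the
  group operations is not listed because it follows from bi-invariance.\<close>

definition bounded_polish_metric_group ::
    "real \<Rightarrow> 'g monoid \<Rightarrow> ('g \<Rightarrow> 'g \<Rightarrow> real) \<Rightarrow> bool" where
  "bounded_polish_metric_group K G d \<longleftrightarrow>
     group G \<and> Metric_space (carrier G) d \<and> bi_invariant G d \<and>
     (\<forall>x \<in> carrier G. \<forall>y \<in> carrier G. d x y \<le> K) \<and>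
     Metric_space.mcomplete (carrier G) d \<and>
     separable_space (Metric_space.mtopology (carrier G) d)"

definition isometric_group_embeddings ::
    "'g monoid \<Rightarrow> ('g \<Rightarrow> 'g \<Rightarrow> real) \<Rightarrow> 'h monoid \<Rightarrow> ('h \<Rightarrow> 'h \<Rightarrow> real) \<Rightarrow> ('g \<Rightarrow> 'h) set" where
  "isometric_group_embeddings G d H e =
     {\<phi> \<in> mon G H. \<forall>x \<in> carrier G. \<forall>y \<in> carrier G. e (\<phi> x) (\<phi> y) = d x y}"

text \<open>The defining property of the groups \<open>D\<^sub>K\<close>. A separable metric space has at most
  continuum many points, so every separable metric group has an isomorphic isometric copy whose
  carrier is a set of reals; quantifying over groups on \<open>real\<close> thus covers all of them.\<close>

definition universal_bounded_polish_metric_group ::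
    "real \<Rightarrow> 'g monoid \<Rightarrow> ('g \<Rightarrow> 'g \<Rightarrow> real) \<Rightarrow> bool" where
  "universal_bounded_polish_metric_group K D d \<longleftrightarrow>
     bounded_polish_metric_group K D d \<and>
     (\<forall>(H :: real monoid) e. bounded_polish_metric_group K H e \<longrightarrow>
        (\<exists>\<phi> \<in> isometric_group_embeddings H e D d.
           closedin (Metric_space.mtopology (carrier D) d) (\<phi> ` carrier H)))"

definition effros_borel :: "'a topology \<Rightarrow> 'a set measure" where
  "effros_borel T =
     sigma {F. closedin T F} {{F. closedin T F \<and> F \<inter> U \<noteq> {}} | U. openin T U}"

definition Subg :: "'g monoid \<Rightarrow> ('g \<Rightarrow> 'g \<Rightarrow> real) \<Rightarrow> 'g set set" where
  "Subg D d = {H. subgroup H D \<and> closedin (Metric_space.mtopology (carrier D) d) H}"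

definition Subg_space :: "'g monoid \<Rightarrow> ('g \<Rightarrow> 'g \<Rightarrow> real) \<Rightarrow> 'g set measure" where
  "Subg_space D d =
     restrict_space (effros_borel (Metric_space.mtopology (carrier D) d)) (Subg D d)"

definition isometric_embeddability ::
    "'g monoid \<Rightarrow> ('g \<Rightarrow> 'g \<Rightarrow> real) \<Rightarrow> ('g set \<times> 'g set) set" where
  "isometric_embeddability D d =
     {(H, H'). H \<in> Subg D d \<and> H' \<in> Subg D d \<and>
        isometric_group_embeddings (D\<lparr>carrier := H\<rparr>) d (D\<lparr>carrier := H'\<rparr>) d \<noteq> {}}"

end

theory Submission
  imports Defs
begin

text \<open>
  A closed subgroup \<open>H\<close> is coded by its distances to a dense sequence of \<open>D\<close>. The codes form a
  \<open>G\<^sub>\<delta>\<close> subset of \<open>\<real>\<^sup>\<nat>\<close>, and the induced topology generates the Effros structure. An isometric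
  embedding is determined by its values on a dense sequence, which gives analyticity.

  For completeness, following Louveau and Rosendal, an analytic quasi-order on binary sequences is
  the projection of a tree whose labels add up under composition: allow finite paths, with the first
  label entry counting the steps; by compactness of the space of binary sequences no new pairs
  arise. The section of this tree at \<open>x\<close> is a coloured graph, the tree of labels with tags attached.
  An embedding between two such graphs maps the zero branch to a witness of the relation, and
  conversely adding a witness is an embedding. The graphs are realised as generating sets of Boolean
  groups of finite sets of vertices, all inside one countable discrete group: a metric with values in
  \<open>[K/2, K]\<close> can record colours and edges arbitrarily. Universality of \<open>D\<close> is used for this one
  group only.
\<close>

section \<open>Analytic sets of sequences\<close>

text \<open>The obstacle is that transitivity of a quasi-order says nothing about finite
  approximations: two triples at one level of a tree for \<open>Q\<close> need not compose.
  Concatenation of paths supplies such a composition, but a path brings intermediate points that are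
  chosen afresh at every level. They converge only because points are coded by 0-1 sequences and
  because a label fixes the number of steps and bounds their witnesses. A path without steps makes
  the all-zero label admissible at every point; this supplies tags that are known in advance and
  whose images can be read off. On the group side an isometry must carry generators to generators,
  so what a set of vertices is has to be readable from its distance to the identity. Since all the
  groups lie in one countable copy, the reduction is Borel for a simple reason: meeting an open set
  is a countable disjunction over finite sets of vertices.\<close>

definition seq_closed :: "((nat \<Rightarrow> nat) \<times> (nat \<Rightarrow> nat)) set \<Rightarrow> bool" where
  "seq_closed C \<longleftrightarrow>
     (\<forall>w z. (\<forall>n. \<exists>w' z'. (w', z') \<in> C \<and> (\<forall>i<n. w' i = w i \<and> z' i = z i)) \<longrightarrow> (w, z) \<in> C)"

lemma seq_closedD:
  assumes "seq_closed C" and "\<And>n. \<exists>w' z'. (w', z') \<in> C \<and> (\<forall>i<n. w' i = w i \<and> z' i = z i)"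
  shows "(w, z) \<in> C"
  using assms unfolding seq_closed_def by blast

text \<open>Projections of closed sets rather than of Borel sets, because closed sets are the branch
  sets of trees, and a tree of initial segments is wanted in the end.\<close>

definition souslin :: "(nat \<Rightarrow> nat) set \<Rightarrow> bool" where
  "souslin A \<longleftrightarrow> (\<exists>C. seq_closed C \<and> A = fst ` C)"

text \<open>The index of the member is stored as entry 0 of the witness. Agreement on a nonempty
  initial segment fixes it, so a limit stays inside a single \<open>C k\<close>.\<close>

lemma souslin_UN:
  assumes "\<And>k::nat. souslin (A k)"
  shows "souslin (\<Union>k. A k)"
proof -
  obtain C where C: "\<And>k. seq_closed (C k)" "\<And>k. A k = fst ` C k"
    using assms unfolding souslin_def by metis
  define E where "E = {(w, z). (w, \<lambda>i. z (Suc i)) \<in> C (z 0)}"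
  have "seq_closed E"
    unfolding seq_closed_def
  proof (intro allI impI)
    fix w z assume *: "\<forall>n. \<exists>w' z'. (w', z') \<in> E \<and> (\<forall>i<n. w' i = w i \<and> z' i = z i)"
    have "(w, \<lambda>i. z (Suc i)) \<in> C (z 0)"
    proof (rule seq_closedD[OF C(1)])
      fix n
      obtain w' z' where "(w', z') \<in> E" "\<forall>i<Suc n. w' i = w i \<and> z' i = z i" using * by blast
      then have "(w', \<lambda>i. z' (Suc i)) \<in> C (z 0)" "\<forall>i<n. w' i = w i \<and> z' (Suc i) = z (Suc i)"
        unfolding E_def by auto
      then show "\<exists>w' z'. (w', z') \<in> C (z 0) \<and> (\<forall>i<n. w' i = w i \<and> z' i = z (Suc i))"
        by (intro exI[of _ w'] exI[of _ "\<lambda>i. z' (Suc i)"]) auto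
    qed
    then show "(w, z) \<in> E" unfolding E_def by simp
  qed
  moreover have "(\<Union>k. A k) = fst ` E"
  proof
    show "(\<Union>k. A k) \<subseteq> fst ` E"
    proof
      fix w assume "w \<in> (\<Union>k. A k)"
      then obtain k z where "(w, z) \<in> C k" using C(2) by force
      then have "(w, case_nat k z) \<in> E" unfolding E_def by simp
      then show "w \<in> fst ` E" by force
    qed
    show "fst ` E \<subseteq> (\<Union>k. A k)"
      unfolding E_def using C(2) by force
  qed
  ultimately show ?thesis unfolding souslin_def by blast
qed

text \<open>One sequence carries the witnesses for all \<open>k\<close> at once, as rows of an array
  under \<open>prod_encode\<close>.\<close>

lemma souslin_INT:
  assumes "\<And>k::nat. souslin (A k)"
  shows "souslin (\<Inter>k. A k)"
proof -
  obtain C where C: "\<And>k. seq_closed (C k)" "\<And>k. A k = fst ` C k"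
    using assms unfolding souslin_def by metis
  define E where "E = {(w, z). \<forall>k. (w, \<lambda>i. z (prod_encode (k, i))) \<in> C k}"
  have "seq_closed E"
    unfolding seq_closed_def
  proof (intro allI impI)
    fix w z assume *: "\<forall>n. \<exists>w' z'. (w', z') \<in> E \<and> (\<forall>i<n. w' i = w i \<and> z' i = z i)"
    have "(w, \<lambda>i. z (prod_encode (k, i))) \<in> C k" for k
    proof (rule seq_closedD[OF C(1)])
      fix n
      \<comment> \<open>\<open>N\<close> exceeds \<open>n\<close> and the positions of the first
        \<open>n\<close> entries of row \<open>k\<close>; the sum is a convenient upper bound for
        these positions.\<close>
      define N where "N = n + Suc (\<Sum>i<n. prod_encode (k, i))"
      have N: "i < N" "prod_encode (k, i) < N" if "i < n" for i
        using that member_le_sum[of i "{..<n}" "\<lambda>i. prod_encode (k, i)"] unfolding N_def by auto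
      obtain w' z' where "(w', z') \<in> E" "\<forall>i<N. w' i = w i \<and> z' i = z i" using * by blast
      then show "\<exists>w' z'. (w', z') \<in> C k \<and> (\<forall>i<n. w' i = w i \<and> z' i = z (prod_encode (k, i)))"
        using N unfolding E_def
        by (intro exI[of _ w'] exI[of _ "\<lambda>i. z' (prod_encode (k, i))"]) auto
    qed
    then show "(w, z) \<in> E" unfolding E_def by simp
  qed
  moreover have "(\<Inter>k. A k) = fst ` E"
  proof
    show "(\<Inter>k. A k) \<subseteq> fst ` E"
    proof
      fix w assume "w \<in> (\<Inter>k. A k)"
      then have "\<forall>k. \<exists>z. (w, z) \<in> C k" using C(2) by force
      then obtain z where "\<And>k. (w, z k) \<in> C k" by metis
      then have "(w, \<lambda>j. z (fst (prod_decode j)) (snd (prod_decode j))) \<in> E"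
        unfolding E_def by simp
      then show "w \<in> fst ` E" by force
    qed
    show "fst ` E \<subseteq> (\<Inter>k. A k)"
      unfolding E_def using C(2) by force
  qed
  ultimately show ?thesis unfolding souslin_def by blast
qed

lemma souslin_coordinate: "souslin {w. P (w i)}"
proof -
  have "seq_closed {(w, z). P (w i)}"
    unfolding seq_closed_def
  proof (intro allI impI)
    fix w z assume "\<forall>n. \<exists>w' z'. (w', z') \<in> {(w, z). P (w i)} \<and> (\<forall>i<n. w' i = w i \<and> z' i = z i)"
    then obtain w' z' where "P (w' i)" "\<forall>j<Suc i. w' j = w j \<and> z' j = z j" by blast
    then show "(w, z) \<in> {(w, z). P (w i)}" by simp
  qed
  moreover have "{w. P (w i)} = fst ` {(w, z). P (w i)}" by force
  ultimately show ?thesis unfolding souslin_def by blast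
qed

text \<open>The class is not closed under complements, so the induction over the generated
  sigma-algebra carries a set together with its complement; a union then calls for both
  \<open>souslin_UN\<close> and \<open>souslin_INT\<close>.\<close>

lemma souslin_borel:
  assumes "A \<in> sets (borel :: (nat \<Rightarrow> nat) measure)"
  shows "souslin A"
proof -
  let ?G = "{{f \<in> (\<Pi>\<^sub>E i\<in>UNIV. space borel). f i \<in> B} | i B. i \<in> UNIV \<and> B \<in> sets borel} :: (nat \<Rightarrow> nat) set set"
  have "A \<in> sigma_sets (\<Pi>\<^sub>E i\<in>UNIV. space borel) ?G"
    using assms unfolding sets_PiM_equal_borel[symmetric] sets_PiM_single .
  then have "souslin A \<and> souslin (UNIV - A)"
  proof (induction rule: sigma_sets.induct)
    case (Basic a)
    then obtain i B where "a = {f. f i \<in> B}" by auto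
    then show ?case
      using souslin_coordinate[of "\<lambda>k. k \<in> B" i] souslin_coordinate[of "\<lambda>k. k \<notin> B" i]
      by (simp add: set_diff_eq)
  next
    case Empty
    then show ?case
      using souslin_coordinate[of "\<lambda>k. False" 0] souslin_coordinate[of "\<lambda>k. True" 0] by simp
  next
    case (Compl a)
    then show ?case by (simp add: double_diff)
  next
    case (Union a)
    have "souslin (\<Union>i. a i)" using Union.IH by (auto intro: souslin_UN)
    moreover have "souslin (\<Inter>i. UNIV - a i)" using Union.IH by (intro souslin_INT) simp
    ultimately show ?case by (simp add: Compl_eq_Diff_UNIV[symmetric])
  qed
  then show ?thesis by simp
qed

lemma coordinate_measurable:
  "(\<lambda>z. z i) \<in> measurable (borel :: (nat \<Rightarrow> nat) measure) (count_space UNIV)"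
proof -
  have "(\<lambda>z :: nat \<Rightarrow> nat. z i) \<in> borel_measurable borel"
    by (intro borel_measurable_continuous_onI continuous_on_product_coordinates)
  then show ?thesis
    using measurable_cong_sets[OF refl sets_borel_eq_count_space] by blast
qed

section \<open>Trees and quasi-orders\<close>

abbreviation pre :: "(nat \<Rightarrow> nat) \<Rightarrow> nat \<Rightarrow> nat list" where
  "pre w n \<equiv> map w [0..<n]"

lemma take_pre: "take k (pre w n) = pre w (min k n)"
  by (simp add: take_map min_def)

lemma pre_eq_iff: "pre v n = pre w n \<longleftrightarrow> (\<forall>i<n. v i = w i)"
  by auto

text \<open>Koenig's lemma with a branching bound that depends on the position. \<open>big s\<close>
  marks the lists with extensions in \<open>S\<close> of every length.\<close>

lemma koenig:
  fixes S :: "nat list set" and b :: "nat \<Rightarrow> nat"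
  assumes take: "\<And>s n. s \<in> S \<Longrightarrow> take n s \<in> S"
    and bound: "\<And>s i. s \<in> S \<Longrightarrow> i < length s \<Longrightarrow> s ! i \<le> b i"
    and ex: "\<And>n. \<exists>s\<in>S. length s = n"
  shows "\<exists>z. \<forall>n. pre z n \<in> S"
proof -
  define big where "big s \<longleftrightarrow> (\<forall>n\<ge>length s. \<exists>t\<in>S. length t = n \<and> take (length s) t = s)" for s
  have big_Nil: "big []" using ex unfolding big_def by auto
  have step: "\<exists>k. big (s @ [k])" if s: "big s" for s
  proof (rule ccontr)
    assume "\<not> ?thesis"
    then have "\<forall>k. \<exists>n\<ge>length (s @ [k]). \<not> (\<exists>t\<in>S. length t = n \<and> take (length (s @ [k])) t = s @ [k])"
      unfolding big_def by blast
    then obtain N where N: "\<And>k. N k \<ge> Suc (length s)"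
      "\<And>k t. t \<in> S \<Longrightarrow> length t = N k \<Longrightarrow> take (Suc (length s)) t \<noteq> s @ [k]"
      by (metis length_append_singleton)
    \<comment> \<open>Only finitely many next entries are admissible, so if each of them dies at
      some length \<open>N k\<close>, the single length \<open>L\<close> defeats them all.\<close>
    define L where "L = Max (N ` {..b (length s)})"
    have L: "N k \<le> L" if "k \<le> b (length s)" for k
      unfolding L_def using that by auto
    have "length s \<le> L" using N(1)[of 0] L[of 0] by simp
    then obtain t where t: "t \<in> S" "length t = L" "take (length s) t = s"
      using s unfolding big_def by blast
    have len: "length s < length t" using N(1)[of 0] L[of 0] t by simp
    define k where "k = t ! length s"
    have "k \<le> b (length s)" unfolding k_def using bound t len by blast
    then have "take (Suc (length s)) (take (N k) t) = s @ [k]" "length (take (N k) t) = N k"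
      using L N(1)[of k] t len by (auto simp: k_def take_Suc_conv_app_nth)
    then show False using N(2) take t(1) by blast
  qed
  define F where "F = rec_nat [] (\<lambda>_ s. s @ [SOME k. big (s @ [k])])"
  define z where "z n = (SOME k. big (F n @ [k]))" for n
  have F: "pre z n = F n" for n by (induction n) (auto simp: F_def z_def)
  have "big (F n)" for n
  proof (induction n)
    case (Suc n)
    then show ?case using someI_ex[OF step] by (simp add: F_def)
  qed (simp add: F_def big_Nil)
  then have "pre z n \<in> S" for n
    unfolding F big_def by (metis take_all order_refl)
  then show ?thesis by blast
qed

section \<open>Paths in a tree and their limits\<close>

lemma relpow_mono: "R \<subseteq> S \<Longrightarrow> R ^^ m \<subseteq> S ^^ m" for R S :: "'b rel"
  by (induction m) auto

text \<open>Binary entries are asked of the first coordinate because an intermediate point of a path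
  that moves on is the first coordinate of a \<open>T0\<close> triple. \<open>Q\<close> is not
  assumed reflexive, hence the alternatives with equality below.\<close>

locale tree_relation =
  fixes Q :: "(nat \<Rightarrow> nat) \<Rightarrow> (nat \<Rightarrow> nat) \<Rightarrow> bool" and T0 :: "nat list \<Rightarrow> nat list \<Rightarrow> nat list \<Rightarrow> bool"
  assumes Q_iff: "Q a b \<longleftrightarrow> (\<exists>z. \<forall>n. T0 (pre a n) (pre b n) (pre z n))"
    and T0_take: "T0 u v s \<Longrightarrow> T0 (take n u) (take n v) (take n s)"
    and T0_length: "T0 u v s \<Longrightarrow> length u = length s \<and> length v = length s"
    and T0_binary: "T0 u v s \<Longrightarrow> i < length u \<Longrightarrow> u ! i \<le> 1"
    and Q_trans: "Q a b \<Longrightarrow> Q b c \<Longrightarrow> Q a c"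
begin

text \<open>Bounding the witness by the label, instead of equating the two, makes the relation
  monotone in the label and leaves finitely many witnesses at each level.\<close>

definition steps :: "nat list \<Rightarrow> nat list rel" where
  "steps s = {(u, v). length u = length s \<and> length v = length s \<and>
            (u = v \<or> (\<exists>s'. list_all2 (\<le>) s' s \<and> T0 u v s'))}"

text \<open>The head of the label counts steps and its tail bounds their witnesses, so labels add up
  under composition.\<close>

definition T :: "nat list \<Rightarrow> nat list \<Rightarrow> nat list \<Rightarrow> bool" where
  "T u v s \<longleftrightarrow> (u, v) \<in> steps (tl s) ^^ hd s"

lemma steps_take: "(u, v) \<in> steps s \<Longrightarrow> (take n u, take n v) \<in> steps (take n s)"
  unfolding steps_def by (auto intro: T0_take list_all2_takeI)

lemma steps_relpow_take: "(u, v) \<in> steps s ^^ m \<Longrightarrow> (take n u, take n v) \<in> steps (take n s) ^^ m"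
proof (induction m arbitrary: v)
  case (Suc m)
  then show ?case using steps_take by (meson relpow_Suc_E relpow_Suc_I)
qed simp

lemma steps_mono: 
  assumes "list_all2 (\<le>) s t" shows "steps s \<subseteq> steps t"
proof -
  have "list_all2 (\<le>) s' t" if "list_all2 (\<le>) s' s" for s'
    using order_trans that assms by (rule list_all2_trans)
  then show ?thesis unfolding steps_def using list_all2_lengthD[OF assms] by auto
qed

lemma T_trans:
  assumes "T u v s" "T v w t" "length s = length t" "s \<noteq> []"
  shows "T u w (map2 (+) s t)"
proof -
  obtain m s' where s: "s = m # s'" using assms by (cases s) auto
  obtain k t' where t: "t = k # t'" using assms by (cases t) auto
  have "steps s' \<subseteq> steps (map2 (+) s' t')" "steps t' \<subseteq> steps (map2 (+) s' t')"
    by (rule steps_mono; use assms s t in \<open>simp add: list_all2_conv_all_nth\<close>)+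
  then have "(u, v) \<in> steps (map2 (+) s' t') ^^ m" "(v, w) \<in> steps (map2 (+) s' t') ^^ k"
    using assms(1,2) s t unfolding T_def by (auto intro: subsetD[OF relpow_mono])
  then show ?thesis unfolding T_def s t by (auto simp: relpow_add)
qed

text \<open>The intermediate points of a path have binary entries and the witnesses are bounded, so
  paths through all finite levels have a limit.\<close>

lemma steps_imp_Q:
  assumes "\<And>n. (pre c n, pre b n) \<in> steps (pre z n)"
  shows "c = b \<or> Q c b"
proof (rule disjCI)
  assume "\<not> Q c b"
  show "c = b"
  proof (rule ccontr)
    assume "c \<noteq> b"
    then obtain j where j: "c j \<noteq> b j" by blast
    define S where "S = {s. T0 (pre c (length s)) (pre b (length s)) s \<and> (\<forall>i<length s. s ! i \<le> z i)}"
    \<comment> \<open>Beyond \<open>j\<close> the prefixes differ, which excludes the diagonal part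
      of \<open>steps\<close> and leaves a genuine witness; shorter ones come by truncation.\<close>
    have long: "\<exists>s\<in>S. length s = n" if "n > j" for n
    proof -
      have "pre c n \<noteq> pre b n" using j that pre_eq_iff by blast
      then obtain s where "list_all2 (\<le>) s (pre z n)" "T0 (pre c n) (pre b n) s"
        using assms[of n] unfolding steps_def by auto
      then show ?thesis unfolding S_def by (auto simp: list_all2_conv_all_nth)
    qed
    have takeS: "take n s \<in> S" if "s \<in> S" for s n
      using that T0_take[of _ _ s n] unfolding S_def by (fastforce simp: take_pre min.commute)
    have "\<exists>y. \<forall>n. pre y n \<in> S"
    proof (rule koenig[OF takeS])
      show "\<exists>s\<in>S. length s = n" for n
        using long[of "Suc (n + j)"] takeS[of _ n] by force
    qed (auto simp: S_def)
    then obtain y where "\<And>n. T0 (pre c n) (pre b n) (pre y n)" unfolding S_def by force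
    then show False using \<open>\<not> Q c b\<close> Q_iff by blast
  qed
qed

text \<open>Induction on the number of steps: the last intermediate points at all levels form a
  tree, and a branch \<open>c\<close> of it splits off the final step.\<close>

lemma steps_relpow_imp_Q:
  assumes "\<And>n. (pre a n, pre b n) \<in> steps (pre z n) ^^ m"
  shows "a = b \<or> Q a b"
  using assms
proof (induction m arbitrary: b)
  case 0
  then have "\<forall>j<n. a j = b j" for n using pre_eq_iff[of a n b] by simp
  then show ?case by (auto simp: fun_eq_iff)
next
  case (Suc m)
  define S where "S = {v. (pre a (length v), v) \<in> steps (pre z (length v)) ^^ m \<and> (v, pre b (length v)) \<in> steps (pre z (length v))}"
  have "\<exists>c. \<forall>n. pre c n \<in> S"
  proof (rule koenig)
    show "take n s \<in> S" if "s \<in> S" for s n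
      using that steps_take[of s "pre b (length s)" "pre z (length s)" n] 
        steps_relpow_take[of "pre a (length s)" s m "pre z (length s)" n]
      unfolding S_def by (auto simp: take_pre min.commute)
    \<comment> \<open>Either the last step is stationary and the point is a prefix of
      \<open>b\<close>, or the point starts a \<open>T0\<close> triple and is binary; the maximum
      covers both.\<close>
    show "s ! i \<le> max 1 (b i)" if "s \<in> S" "i < length s" for s i
    proof (cases "s = pre b (length s)")
      case True
      then have "s ! i = pre b (length s) ! i" by simp
      then show ?thesis using that(2) by simp
    next
      case False
      then show ?thesis using that T0_binary[of s _ _ i] unfolding S_def steps_def by fastforce
    qed
    show "\<exists>s\<in>S. length s = n" for n
    proof -
      obtain v where "(pre a n, v) \<in> steps (pre z n) ^^ m" "(v, pre b n) \<in> steps (pre z n)"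
        using Suc.prems[of n] by auto
      moreover from this(2) have "length v = n" unfolding steps_def by auto
      ultimately show ?thesis unfolding S_def by auto
    qed
  qed
  then obtain c where c: "\<And>n. (pre a n, pre c n) \<in> steps (pre z n) ^^ m" "\<And>n. (pre c n, pre b n) \<in> steps (pre z n)"
    unfolding S_def by auto
  show ?case
    using Suc.IH[OF c(1)] steps_imp_Q[OF c(2)] Q_trans by blast
qed

text \<open>The head of the label is the same number \<open>z 0\<close> at all levels, so the number
  of steps stays fixed as \<open>n\<close> grows. This head is also why labels are one entry longer
  than prefixes.\<close>

lemma T_imp_Q:
  assumes "\<And>n. T (pre a n) (pre b n) (pre z (Suc n))"
  shows "a = b \<or> Q a b"
proof (rule steps_relpow_imp_Q)
  show "(pre a n, pre b n) \<in> steps (pre (\<lambda>i. z (Suc i)) n) ^^ z 0" for n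
    using assms[of n] unfolding T_def by (simp add: upt_conv_Cons map_Suc_upt[symmetric] comp_def del: upt_Suc)
qed

lemma Q_imp_T:
  assumes "Q a b"
  obtains z where "\<And>n. T (pre a n) (pre b n) (pre z (Suc n))"
proof -
  obtain y where "\<And>n. T0 (pre a n) (pre b n) (pre y n)" using assms Q_iff by blast
  moreover have "list_all2 (\<le>) (pre y n) (pre y n)" for n by (simp add: list_all2_conv_all_nth)
  ultimately have "(pre a n, pre b n) \<in> steps (pre y n)" for n unfolding steps_def by auto
  \<comment> \<open>The head 1 counts the single step made.\<close>
  then have "T (pre a n) (pre b n) (pre (case_nat 1 y) (Suc n))" for n
    unfolding T_def by (simp add: upt_conv_Cons map_Suc_upt[symmetric] comp_def del: upt_Suc)
  then show thesis using that by blast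
qed

end

section \<open>The coloured graph attached to a point\<close>

datatype vertex = Node "nat list" | Tag "nat list" "nat list"

instance vertex :: countable
  by countable_datatype

text \<open>Parity tells nodes from tags. Colours reveal the level of a node and the point
  \<open>u\<close> of a tag, but not the labels, which a graph map is meant to shift.\<close>

fun vcolour :: "vertex \<Rightarrow> nat" where
  "vcolour (Node s) = 2 * length s"
| "vcolour (Tag u s) = 2 * to_nat u + 1"

text \<open>Oriented from parent to child and from a node to its tags. The groups see only unordered
  pairs; the orientation is recovered from the colours.\<close>

fun vedge :: "vertex \<Rightarrow> vertex \<Rightarrow> bool" where
  "vedge (Node s) (Node t) = (\<exists>k. t = s @ [k])"
| "vedge (Node s) (Tag u t) = (s = t)"
| "vedge _ _ = False"

lemma vedge_irrefl: "vedge v w \<Longrightarrow> v \<noteq> w"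
  by (cases v; cases w) auto

context tree_relation
begin

text \<open>The tree of nodes is the same for all points and only the tags depend on
  \<open>a\<close>. A label of length n + 1 belongs to level n, whence
  \<open>length s - 1\<close>.\<close>

definition vertices :: "(nat \<Rightarrow> nat) \<Rightarrow> vertex set" where
  "vertices a = range Node \<union> {Tag u s | u s. s \<noteq> [] \<and> T u (pre a (length s - 1)) s}"

text \<open>Translation of labels by a branch \<open>z\<close> for the pair of \<open>a\<close> and
  \<open>b\<close> is injective and respects one-entry extensions both ways; \<open>T_trans\<close>
  puts the translated tags of \<open>a\<close> among those of \<open>b\<close>.\<close>

lemma Q_imp_vertex_map:
  assumes "Q a b"
  obtains g where "inj g" "g ` vertices a \<subseteq> vertices b" "\<And>v. vcolour (g v) = vcolour v"
    "\<And>v w. vedge (g v) (g w) \<longleftrightarrow> vedge v w"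
proof -
  obtain z where z: "\<And>n. T (pre a n) (pre b n) (pre z (Suc n))" using Q_imp_T[OF assms] by blast
  define sh where "sh s = map2 (+) s (pre z (length s))" for s
  have len: "length (sh s) = length s" for s unfolding sh_def by simp
  have nth: "sh s ! i = s ! i + z i" if "i < length s" for s i using that unfolding sh_def by simp
  have inj: "s = t" if "sh s = sh t" for s t
  proof (rule nth_equalityI)
    show l: "length s = length t" using that len by metis
    fix i assume "i < length s"
    then show "s ! i = t ! i" using nth[of i s] nth[of i t] that l by simp
  qed
  have app: "sh (s @ [k]) = sh s @ [k + z (length s)]" for s k unfolding sh_def by simp
  have edge: "(\<exists>k. sh t = sh s @ [k]) \<longleftrightarrow> (\<exists>k. t = s @ [k])" for s t
  proof
    assume "\<exists>k. sh t = sh s @ [k]"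
    then obtain k where k: "sh t = sh s @ [k]" by blast
    then have "t \<noteq> []" unfolding sh_def by auto
    then obtain t' j where "t = t' @ [j]" by (metis append_butlast_last_id)
    then show "\<exists>k. t = s @ [k]" using k app inj by fastforce
  qed (auto simp: app)
  define g where "g v = (case v of Node s \<Rightarrow> Node (sh s) | Tag u s \<Rightarrow> Tag u (sh s))" for v
  show thesis
  proof
    show "inj g" unfolding g_def inj_def using inj by (auto split: vertex.splits)
    show "vcolour (g v) = vcolour v" for v unfolding g_def by (cases v) (auto simp: len)
    show "vedge (g v) (g w) \<longleftrightarrow> vedge v w" for v w
      unfolding g_def using edge inj by (cases v; cases w) auto
    show "g ` vertices a \<subseteq> vertices b"
    proof (rule image_subsetI)
      fix v assume v: "v \<in> vertices a"
      show "g v \<in> vertices b"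
      proof (cases v)
        case (Tag u s)
        then have s: "s \<noteq> []" "T u (pre a (length s - 1)) s" using v unfolding vertices_def by auto
        then have "T u (pre b (length s - 1)) (sh s)"
          using z[of "length s - 1"] T_trans[of u _ s] unfolding sh_def by simp
        then show ?thesis using s len[of s] unfolding vertices_def g_def Tag by auto
      qed (simp add: g_def vertices_def)
    qed
  qed
qed

text \<open>Colours and edges force nodes to move level by level along the tree, so the branch of
  zero labels goes to a branch \<open>z\<close>. The tags of prefixes of \<open>a\<close> on the
  zero branch are available, and their images are the triples that \<open>T_imp_Q\<close> asks
  for.\<close>

lemma vertex_map_imp_Q:
  assumes sub: "g ` vertices a \<subseteq> vertices b"
    and col: "\<And>v. v \<in> vertices a \<Longrightarrow> vcolour (g v) = vcolour v"
    and edge: "\<And>v w. v \<in> vertices a \<Longrightarrow> w \<in> vertices a \<Longrightarrow> vedge v w \<Longrightarrow> vedge (g v) (g w) \<or> vedge (g w) (g v)"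
  shows "a = b \<or> Q a b"
proof -
  have node: "Node s \<in> vertices a" for s unfolding vertices_def by simp
  have "\<exists>t. g (Node s) = Node t \<and> length t = length s" for s
    using col[OF node[of s]] by (cases "g (Node s)") (auto simp: even_Suc dest: arg_cong[of _ _ even])
  then obtain h where h: "\<And>s. g (Node s) = Node (h s)" "\<And>s. length (h s) = length s" by metis
  have "\<exists>k. h (s @ [j]) = h s @ [k]" for s j
  proof -
    \<comment> \<open>The map may reverse edges; equality of levels rules this out between
      nodes.\<close>
    have "h s \<noteq> h (s @ [j]) @ [k]" for k
    proof
      assume "h s = h (s @ [j]) @ [k]"
      then have "length (h s) = length (h (s @ [j])) + 1" by simp
      then show False by (simp add: h(2))
    qed
    then show ?thesis using edge[OF node[of s] node[of "s @ [j]"]] unfolding h by auto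
  qed
  then have "\<forall>s. \<exists>k. h (s @ [0]) = h s @ [k]" by blast
  then obtain k where k: "\<And>s. h (s @ [0]) = h s @ [k s]" by metis
  define z where "z n = k (replicate n 0)" for n
  have z: "h (replicate n 0) = pre z n" for n
  proof (induction n)
    case (Suc n)
    then show ?case using k[of "replicate n 0"] by (simp add: z_def replicate_append_same)
  qed (use h(2)[of "[]"] in simp)
  show ?thesis
  proof (rule T_imp_Q)
    fix n
    define s :: "nat list" where "s = replicate (Suc n) 0"
    define v where "v = Tag (pre a n) s"
    \<comment> \<open>The label starts with 0, that is, it allows the path without steps, which
      joins \<open>pre a n\<close> to itself.\<close>
    have v: "v \<in> vertices a" unfolding v_def vertices_def s_def T_def by simp
    have "vcolour (g v) = 2 * to_nat (pre a n) + 1" using col[OF v] by (simp add: v_def)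
    then obtain t where t: "g v = Tag (pre a n) t"
      by (cases "g v") (auto dest: arg_cong[of _ _ even])
    \<comment> \<open>A tag is adjacent to one node only, so its label follows the image of that
      node.\<close>
    have "t = h s" using edge[OF node[of s] v] unfolding t h by (simp add: v_def)
    then have "t = pre z (Suc n)" using z s_def by metis
    moreover have "g v \<in> vertices b" using sub v by blast
    ultimately show "T (pre a n) (pre b n) (pre z (Suc n))" unfolding t vertices_def by auto
  qed
qed

end

section \<open>Complete separable groups with a bi-invariant metric\<close>

locale polish_group =
  fixes K :: real and D :: "'g monoid" and d :: "'g \<Rightarrow> 'g \<Rightarrow> real"
  assumes polish: "bounded_polish_metric_group K D d"
begin

sublocale group D
  using polish unfolding bounded_polish_metric_group_def by blast

sublocale Metric_space "carrier D" d
  using polish unfolding bounded_polish_metric_group_def by blast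

lemma complete: mcomplete
  and separable: "separable_space mtopology"
  using polish unfolding bounded_polish_metric_group_def by blast+

lemma d_mult_left: "\<lbrakk>x \<in> carrier D; y \<in> carrier D; z \<in> carrier D\<rbrakk> \<Longrightarrow> d (z \<otimes>\<^bsub>D\<^esub> x) (z \<otimes>\<^bsub>D\<^esub> y) = d x y"
  and d_mult_right: "\<lbrakk>x \<in> carrier D; y \<in> carrier D; z \<in> carrier D\<rbrakk> \<Longrightarrow> d (x \<otimes>\<^bsub>D\<^esub> z) (y \<otimes>\<^bsub>D\<^esub> z) = d x y"
  using polish unfolding bounded_polish_metric_group_def bi_invariant_def by blast+

end

section \<open>Boolean groups over coloured graphs\<close>

text \<open>A function on a Boolean group that is \<open>0\<close> at the identity and takes values in \<open>[K/2, K]\<close>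
  elsewhere satisfies the triangle inequality, so the norm of a set is free to record whether it
  is a vertex of a given colour, an edge, or neither.\<close>

definition kind :: "('v \<Rightarrow> nat) \<Rightarrow> ('v \<Rightarrow> 'v \<Rightarrow> bool) \<Rightarrow> 'v set \<Rightarrow> nat" where
  "kind c E A =
     (if is_singleton A then 2 + c (the_elem A)
      else if \<exists>v w. v \<noteq> w \<and> E v w \<and> A = {v, w} then 1 else 0)"

text \<open>The map from k to K/2 + (K/2)/(1 + k) is an injection of the naturals into the interval
  from K/2 to K, so the kind can be recovered from the norm.\<close>

definition kind_norm :: "real \<Rightarrow> ('v \<Rightarrow> nat) \<Rightarrow> ('v \<Rightarrow> 'v \<Rightarrow> bool) \<Rightarrow> 'v set \<Rightarrow> real" where
  "kind_norm K c E A = (if A = {} then 0 else K / 2 + K / 2 / (1 + real (kind c E A)))"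

lemma kind_norm_bounds:
  assumes "K > 0" "A \<noteq> {}"
  shows "K / 2 \<le> kind_norm K c E A" "kind_norm K c E A \<le> K"
proof -
  define x where "x = K / 2 / (1 + real (kind c E A))"
  have "0 \<le> x" "x \<le> K / 2" "kind_norm K c E A = K / 2 + x"
    using assms by (auto simp: x_def kind_norm_def field_simps)
  then show "K / 2 \<le> kind_norm K c E A" "kind_norm K c E A \<le> K" by linarith+
qed

lemma kind_norm_eq_iff:
  assumes "K > 0"
  shows "kind_norm K c E A = kind_norm K c E B \<longleftrightarrow> (A = {} \<longleftrightarrow> B = {}) \<and> (A \<noteq> {} \<longrightarrow> kind c E A = kind c E B)"
proof (cases "A = {} \<or> B = {}")
  case True
  moreover have "kind_norm K c E C \<noteq> kind_norm K c E {}" if "C \<noteq> {}" for C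
    using kind_norm_bounds(1)[OF assms that, of c E] assms by (simp add: kind_norm_def[of K c E "{}"])
  ultimately show ?thesis by metis
next
  case False
  then show ?thesis using assms unfolding kind_norm_def by (auto simp: field_simps)
qed

locale universal_group = polish_group K D d
  for K :: real and D :: "'g monoid" and d :: "'g \<Rightarrow> 'g \<Rightarrow> real" +
  assumes K_pos: "K > 0" and univ: "universal_bounded_polish_metric_group K D d"
begin

text \<open>Distinct points are at least K/2 apart, so the finite sets under symmetric difference
  form a uniformly discrete group, which is complete; being countable, it is separable.\<close>

lemma boolean_group_embeds:
  fixes N :: "'v::countable set \<Rightarrow> real"
  assumes N0: "N {} = 0" and N: "\<And>A. A \<noteq> {} \<Longrightarrow> K / 2 \<le> N A" "\<And>A. A \<noteq> {} \<Longrightarrow> N A \<le> K"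
  obtains \<phi> where "\<And>A. finite A \<Longrightarrow> \<phi> A \<in> carrier D"
    "\<And>A B. finite A \<Longrightarrow> finite B \<Longrightarrow> \<phi> (sym_diff A B) = \<phi> A \<otimes>\<^bsub>D\<^esub> \<phi> B"
    "\<And>A B. finite A \<Longrightarrow> finite B \<Longrightarrow> d (\<phi> A) (\<phi> B) = N (sym_diff A B)"
proof -
  \<comment> \<open>Universality is stated for groups of real numbers, so a finite set of vertices
    is coded by a natural number and read as a real.\<close>
  define enc where "enc A = real (set_encode (to_nat ` A))" for A :: "'v set"
  define F where "F = {A :: 'v set. finite A}"
  have inj: "inj_on enc F"
  proof (rule inj_onI)
    fix A B assume "A \<in> F" "B \<in> F" "enc A = enc B"
    then have "(to_nat ` A :: nat set) = to_nat ` B"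
      unfolding enc_def F_def using set_encode_inf set_encode_eq[of "to_nat ` A" "to_nat ` B"] by simp
    then show "A = B" by (simp add: inj_image_eq_iff)
  qed
  define dec where "dec = the_inv_into F enc"
  have dec: "dec (enc A) = A" if "finite A" for A
    unfolding dec_def using inj that by (simp add: the_inv_into_f_f F_def)
  define H where "H = \<lparr>carrier = enc ` F, monoid.mult = (\<lambda>a b. enc (sym_diff (dec a) (dec b))), one = enc {}\<rparr>"
  define e where "e a b = N (sym_diff (dec a) (dec b))" for a b
  have simps: "carrier H = enc ` F" "\<one>\<^bsub>H\<^esub> = enc {}" "a \<otimes>\<^bsub>H\<^esub> b = enc (sym_diff (dec a) (dec b))" for a b
    unfolding H_def by simp_all
  have N_nonneg: "0 \<le> N A" for A using N0 N[of A] K_pos by (cases "A = {}") auto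
  have sd: "sym_diff A B = {} \<longleftrightarrow> A = B" for A B :: "'v set" by blast
  have "group H"
  proof (rule groupI)
    show "\<exists>y\<in>carrier H. y \<otimes>\<^bsub>H\<^esub> x = \<one>\<^bsub>H\<^esub>" if "x \<in> carrier H" for x
      using that by (auto simp: simps dec F_def)
    show "x \<otimes>\<^bsub>H\<^esub> y \<otimes>\<^bsub>H\<^esub> z = x \<otimes>\<^bsub>H\<^esub> (y \<otimes>\<^bsub>H\<^esub> z)"
      if "x \<in> carrier H" "y \<in> carrier H" "z \<in> carrier H" for x y z
    proof -
      have *: "sym_diff (sym_diff A B) C = sym_diff A (sym_diff B C)" for A B C :: "'v set" by blast
      show ?thesis using that by (auto simp: simps dec F_def *)
    qed
  qed (auto simp: simps dec F_def)
  moreover have M: "Metric_space (carrier H) e"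
  proof
    show "0 \<le> e x y" for x y unfolding e_def by (rule N_nonneg)
    show "e x y = e y x" for x y unfolding e_def by (simp add: Un_commute)
    show "e x y = 0 \<longleftrightarrow> x = y" if xy: "x \<in> carrier H" "y \<in> carrier H" for x y
    proof -
      obtain A B where AB: "x = enc A" "y = enc B" "finite A" "finite B"
        using xy unfolding simps F_def by blast
      have "N (sym_diff A B) = 0 \<longleftrightarrow> A = B"
        using N0 N(1)[of "sym_diff A B"] K_pos sd[of A B] by (cases "A = B") auto
      then show ?thesis using AB dec unfolding e_def by metis
    qed
    show "e x z \<le> e x y + e y z" if "x \<in> carrier H" "y \<in> carrier H" "z \<in> carrier H" for x y z
    proof (cases "dec x = dec y \<or> dec y = dec z")
      case True
      then show ?thesis using N0 unfolding e_def by auto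
    next
      case False
      \<comment> \<open>Two nonzero sides already sum to at least K, the largest possible third
        side.\<close>
      then have "K / 2 \<le> e x y" "K / 2 \<le> e y z" 
        unfolding e_def using N(1)[of "sym_diff (dec x) (dec y)"] N(1)[of "sym_diff (dec y) (dec z)"] sd by metis+
      moreover have "e x z \<le> K"
        unfolding e_def using N(2) N0 K_pos by (metis less_le)
      ultimately show ?thesis by simp
    qed
  qed
  moreover have "bi_invariant H e"
    unfolding bi_invariant_def e_def simps
    by (auto simp: dec F_def intro!: arg_cong[of _ _ N])
  moreover have "e x y \<le> K" for x y
    unfolding e_def using N(2) N0 K_pos by (metis less_le)
  moreover have "Metric_space.mcomplete (carrier H) e"
    unfolding Metric_space.mcomplete_def[OF M]
  proof (intro allI impI)
    fix s assume s: "Metric_space.MCauchy (carrier H) e s"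
    then have ran: "range s \<subseteq> carrier H" and "\<exists>n0. \<forall>n n'. n0 \<le> n \<longrightarrow> n0 \<le> n' \<longrightarrow> e (s n) (s n') < K / 2"
      using half_gt_zero[OF K_pos] unfolding Metric_space.MCauchy_def[OF M] by blast+
    then obtain n0 where n0: "\<And>n. n0 \<le> n \<Longrightarrow> e (s n) (s n0) < K / 2" by blast
    have "s n = s n0" if "n0 \<le> n" for n
    proof -
      have "dec (s n) = dec (s n0)"
        using n0[OF that] N(1)[of "sym_diff (dec (s n)) (dec (s n0))"] sd[of "dec (s n)" "dec (s n0)"]
        unfolding e_def by linarith
      moreover have "s n \<in> enc ` F" "s n0 \<in> enc ` F" using ran by (auto simp: simps)
      ultimately show ?thesis by (auto simp: dec F_def)
    qed
    then have "eventually (\<lambda>n. s n = s n0) sequentially"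
      unfolding eventually_sequentially by blast
    then have "limitin (Metric_space.mtopology (carrier H) e) s (s n0) sequentially"
      using ran limitin_eventually[of "s n0" "Metric_space.mtopology (carrier H) e" s sequentially]
        Metric_space.topspace_mtopology[OF M] by auto
    then show "\<exists>x. limitin (Metric_space.mtopology (carrier H) e) s x sequentially" by blast
  qed
  moreover have "separable_space (Metric_space.mtopology (carrier H) e)"
  proof -
    have "countable (carrier H)"
      unfolding simps enc_def by (rule countable_subset[of _ "range real"]) auto
    then show ?thesis
      unfolding separable_space_def using Metric_space.topspace_mtopology[OF M]
      by (metis closure_of_topspace order_refl)
  qed
  ultimately have "bounded_polish_metric_group K H e"
    unfolding bounded_polish_metric_group_def by blast
  then obtain \<psi> where \<psi>: "\<psi> \<in> isometric_group_embeddings H e D d"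
    using univ unfolding universal_bounded_polish_metric_group_def by blast
  then have hom: "\<psi> \<in> hom H D" and iso: "\<And>x y. x \<in> carrier H \<Longrightarrow> y \<in> carrier H \<Longrightarrow> d (\<psi> x) (\<psi> y) = e x y"
    unfolding isometric_group_embeddings_def mon_def by auto
  show thesis
  proof
    show "\<psi> (enc A) \<in> carrier D" if "finite A" for A
      using hom_in_carrier[OF hom] that by (simp add: simps F_def)
    show "\<psi> (enc (sym_diff A B)) = \<psi> (enc A) \<otimes>\<^bsub>D\<^esub> \<psi> (enc B)" if "finite A" "finite B" for A B
      using hom_mult[OF hom, of "enc A" "enc B"] that by (simp add: simps F_def dec)
    show "d (\<psi> (enc A)) (\<psi> (enc B)) = N (sym_diff A B)" if "finite A" "finite B" for A B
      using iso[of "enc A" "enc B"] that by (simp add: simps F_def dec e_def)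
  qed
qed

end

section \<open>Subgroups spanned by sets of vertices\<close>

locale boolean_copy = universal_group K D d
  for K :: real and D :: "'g monoid" and d :: "'g \<Rightarrow> 'g \<Rightarrow> real" +
  fixes \<phi> :: "'v::countable set \<Rightarrow> 'g" and c :: "'v \<Rightarrow> nat" and E :: "'v \<Rightarrow> 'v \<Rightarrow> bool"
  assumes \<phi>_closed: "finite A \<Longrightarrow> \<phi> A \<in> carrier D"
    and \<phi>_mult: "finite A \<Longrightarrow> finite B \<Longrightarrow> \<phi> (sym_diff A B) = \<phi> A \<otimes>\<^bsub>D\<^esub> \<phi> B"
    and \<phi>_dist: "finite A \<Longrightarrow> finite B \<Longrightarrow> d (\<phi> A) (\<phi> B) = kind_norm K c E (sym_diff A B)"
begin

text \<open>The subgroup generated by the elements \<open>\<phi> {v}\<close> with \<open>v\<close>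
  in \<open>W\<close>; it can be listed outright because products are symmetric differences.\<close>

definition subgr :: "'v set \<Rightarrow> 'g set" where
  "subgr W = \<phi> ` {A. finite A \<and> A \<subseteq> W}"

lemma \<phi>_separated:
  assumes "finite A" "finite B" "d (\<phi> A) (\<phi> B) < K / 2"
  shows "A = B"
proof (rule ccontr)
  assume "A \<noteq> B"
  then have "sym_diff A B \<noteq> {}" by blast
  then show False
    using assms(3) kind_norm_bounds(1)[OF K_pos, of "sym_diff A B" c E] unfolding \<phi>_dist[OF assms(1,2)]
    by simp
qed

lemma \<phi>_inj: "finite A \<Longrightarrow> finite B \<Longrightarrow> \<phi> A = \<phi> B \<Longrightarrow> A = B"
  using \<phi>_separated K_pos \<phi>_closed by simp

lemma \<phi>_empty: "\<phi> {} = \<one>\<^bsub>D\<^esub>"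
  using \<phi>_mult[of "{}" "{}"] \<phi>_closed[of "{}"] by simp

text \<open>Every element is its own inverse, and a set whose points keep distance K/2 from each
  other is closed.\<close>

lemma subgr_in_Subg: "subgr W \<in> Subg D d"
proof -
  have "subgroup (subgr W) D"
  proof
    show "subgr W \<subseteq> carrier D" unfolding subgr_def using \<phi>_closed by auto
    show "\<one>\<^bsub>D\<^esub> \<in> subgr W" unfolding subgr_def \<phi>_empty[symmetric] by blast
    show "x \<otimes>\<^bsub>D\<^esub> y \<in> subgr W" if "x \<in> subgr W" "y \<in> subgr W" for x y
      using that unfolding subgr_def by (force simp: \<phi>_mult[symmetric])
    show "inv\<^bsub>D\<^esub> x \<in> subgr W" if x: "x \<in> subgr W" for x
    proof -
      obtain A where A: "finite A" "x = \<phi> A" using x unfolding subgr_def by blast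
      have "x \<otimes>\<^bsub>D\<^esub> x = \<one>\<^bsub>D\<^esub>" using \<phi>_mult[of A A] \<phi>_empty A by simp
      then have "inv\<^bsub>D\<^esub> x = x" using A \<phi>_closed by (simp add: inv_equality)
      then show ?thesis using x by simp
    qed
  qed
  moreover have "closedin mtopology (subgr W)"
    unfolding closedin_metric
  proof (intro conjI allI impI)
    show "subgr W \<subseteq> carrier D" unfolding subgr_def using \<phi>_closed by auto
    fix x assume x: "x \<in> carrier D - subgr W"
    show "\<exists>r>0. disjnt (subgr W) (mball x r)"
    \<comment> \<open>A ball of radius K/4 holds at most one point of the subgroup, and shrinking
      the radius to \<open>d x (\<phi> A)\<close> expels that point.\<close>
    proof (cases "disjnt (subgr W) (mball x (K / 4))")
      case True
      then show ?thesis using K_pos by (intro exI[of _ "K / 4"]) auto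
    next
      case False
      then obtain A where A: "finite A" "A \<subseteq> W" "d x (\<phi> A) < K / 4"
        unfolding disjnt_iff subgr_def by auto
      then have pos: "d x (\<phi> A) > 0" using x \<phi>_closed unfolding subgr_def by (metis (mono_tags, lifting) DiffD1 DiffD2 image_eqI mdist_pos_less mem_Collect_eq)
      have "disjnt (subgr W) (mball x (d x (\<phi> A)))"
        unfolding disjnt_iff
      proof (intro allI notI, elim conjE)
        fix y assume "y \<in> subgr W" and y: "y \<in> mball x (d x (\<phi> A))"
        then obtain B where B: "finite B" "y = \<phi> B" unfolding subgr_def by blast
        have "d (\<phi> A) (\<phi> B) \<le> d x (\<phi> A) + d x (\<phi> B)"
          using triangle'[of "\<phi> A" x "\<phi> B"] x A B \<phi>_closed commute by (metis DiffD1 triangle)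
        then have "A = B" using A B y by (intro \<phi>_separated) auto
        then show False using y B by simp
      qed
      then show ?thesis using pos by blast
    qed
  qed
  ultimately show ?thesis unfolding Subg_def by blast
qed

text \<open>Only countably many finite sets \<open>A\<close> have \<open>\<phi> A\<close> in a given
  open set \<open>U\<close>. The subgroup meets \<open>U\<close> iff one of them is contained in
  \<open>W x\<close>, a finite conjunction of measurable conditions.\<close>

lemma subgr_measurable:
  assumes "\<And>v. {x \<in> space X. v \<in> W x} \<in> sets X"
  shows "(\<lambda>x. subgr (W x)) \<in> measurable X (Subg_space D d)"
  unfolding Subg_space_def
proof (rule measurable_restrict_space2)
  show "(\<lambda>x. subgr (W x)) \<in> space X \<rightarrow> Subg D d" using subgr_in_Subg by blast
  show "(\<lambda>x. subgr (W x)) \<in> measurable X (effros_borel mtopology)"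
    unfolding effros_borel_def
  proof (rule measurable_measure_of)
    show "{{F. closedin mtopology F \<and> F \<inter> U \<noteq> {}} |U. openin mtopology U} \<subseteq> Pow {F. closedin mtopology F}"
      by blast
    show "(\<lambda>x. subgr (W x)) \<in> space X \<rightarrow> {F. closedin mtopology F}"
      using subgr_in_Subg unfolding Subg_def by blast
    fix y assume "y \<in> {{F. closedin mtopology F \<and> F \<inter> U \<noteq> {}} |U. openin mtopology U}"
    then obtain U where y: "y = {F. closedin mtopology F \<and> F \<inter> U \<noteq> {}}" by blast
    have "(\<lambda>x. subgr (W x)) -` y \<inter> space X = (\<Union>A\<in>{A. finite A \<and> \<phi> A \<in> U}. {x \<in> space X. A \<subseteq> W x})"
      using subgr_in_Subg unfolding y Subg_def subgr_def by auto
    also have "\<dots> \<in> sets X"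
    proof (rule sets.countable_UN'')
      show "countable {A. finite A \<and> \<phi> A \<in> U}"
        by (rule countable_subset[OF _ countable_Collect_finite]) auto
      show "{x \<in> space X. A \<subseteq> W x} \<in> sets X" if "A \<in> {A. finite A \<and> \<phi> A \<in> U}" for A
        using sets.sets_Collect_finite_All[of A X "\<lambda>v x. v \<in> W x"] assms that by (simp add: subset_iff Ball_def)
    qed
    finally show "(\<lambda>x. subgr (W x)) -` y \<inter> space X \<in> sets X" .
  qed
qed

lemma kind_image:
  assumes "inj_on g W" "A \<subseteq> W" and col: "\<And>v. v \<in> W \<Longrightarrow> c (g v) = c v"
    and edge: "\<And>v w. v \<in> W \<Longrightarrow> w \<in> W \<Longrightarrow> E (g v) (g w) \<longleftrightarrow> E v w"
  shows "kind c E (g ` A) = kind c E A"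
proof -
  have inj: "inj_on g A" using assms inj_on_subset by blast
  have sing: "is_singleton (g ` A) \<longleftrightarrow> is_singleton A"
    using inj by (auto simp: is_singleton_altdef card_image)
  have col': "c (the_elem (g ` A)) = c (the_elem A)" if "is_singleton A"
    using that assms(2) col by (auto simp: is_singleton_def)
  have "(\<exists>v w. v \<noteq> w \<and> E v w \<and> g ` A = {v, w}) \<longleftrightarrow> (\<exists>v w. v \<noteq> w \<and> E v w \<and> A = {v, w})" (is "?L \<longleftrightarrow> ?R")
  proof
    assume ?L
    then obtain v' w' where vw: "v' \<noteq> w'" "E v' w'" "g ` A = {v', w'}" by blast
    then obtain v w where v: "v \<in> A" "w \<in> A" "v' = g v" "w' = g w" by blast
    have "A = {v, w}"
    proof
      show "A \<subseteq> {v, w}"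
      proof
        fix x assume x: "x \<in> A"
        then have "g x \<in> {g v, g w}" using vw v by blast
        then show "x \<in> {v, w}" using inj x v by (auto dest: inj_onD)
      qed
    qed (use v in auto)
    then show ?R using vw v edge assms(2) by (intro exI[of _ v] exI[of _ w]) auto
  next
    assume ?R
    then obtain v w where vw: "v \<noteq> w" "E v w" "A = {v, w}" by blast
    then have "g v \<noteq> g w" "E (g v) (g w)" using inj edge assms(2) by (auto simp: inj_on_def)
    then show ?L using vw by auto
  qed
  then show ?thesis unfolding kind_def sing using col' by simp
qed

text \<open>Taking images under an injective \<open>g\<close> respects symmetric differences. Edges
  must be reflected as well as preserved, since the norm also records that a set is not an
  edge.\<close>

lemma embeddable_if_graph_embedding:
  assumes inj: "inj_on g W" and sub: "g ` W \<subseteq> W'" and col: "\<And>v. v \<in> W \<Longrightarrow> c (g v) = c v"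
    and edge: "\<And>v w. v \<in> W \<Longrightarrow> w \<in> W \<Longrightarrow> E (g v) (g w) \<longleftrightarrow> E v w"
  shows "(subgr W, subgr W') \<in> isometric_embeddability D d"
proof -
  \<comment> \<open>\<open>THE\<close> refers to a unique set because \<open>\<phi>\<close> is
    injective on finite sets.\<close>
  define \<psi> where "\<psi> x = \<phi> (g ` (THE A. finite A \<and> A \<subseteq> W \<and> x = \<phi> A))" for x
  have \<psi>: "\<psi> (\<phi> A) = \<phi> (g ` A)" if "finite A" "A \<subseteq> W" for A
  proof -
    have "(THE B. finite B \<and> B \<subseteq> W \<and> \<phi> A = \<phi> B) = A"
      using that \<phi>_inj by (intro the_equality) auto
    then show ?thesis unfolding \<psi>_def by simp
  qed
  have g_sd: "g ` sym_diff A B = sym_diff (g ` A) (g ` B)" if "A \<subseteq> W" "B \<subseteq> W" for A B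
  proof -
    have "g ` (A - B) = g ` A - g ` B" "g ` (B - A) = g ` B - g ` A"
      using that by (auto intro!: inj_on_image_set_diff[OF inj])
    then show ?thesis by (simp add: image_Un)
  qed
  have iso: "d (\<psi> (\<phi> A)) (\<psi> (\<phi> B)) = d (\<phi> A) (\<phi> B)" if "finite A" "A \<subseteq> W" "finite B" "B \<subseteq> W" for A B
  proof -
    have "sym_diff A B \<subseteq> W" using that by blast
    then have "kind_norm K c E (g ` sym_diff A B) = kind_norm K c E (sym_diff A B)"
      using kind_norm_eq_iff[OF K_pos] kind_image[OF inj _ col edge] by (metis image_is_empty)
    then show ?thesis using that by (simp add: \<psi> \<phi>_dist g_sd)
  qed
  have "\<psi> \<in> hom (D\<lparr>carrier := subgr W\<rparr>) (D\<lparr>carrier := subgr W'\<rparr>)"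
  proof (rule homI)
    fix x assume "x \<in> carrier (D\<lparr>carrier := subgr W\<rparr>)"
    then obtain A where A: "finite A" "A \<subseteq> W" "x = \<phi> A" unfolding subgr_def by auto
    show "\<psi> x \<in> carrier (D\<lparr>carrier := subgr W'\<rparr>)"
      using A \<psi> sub unfolding subgr_def by (auto intro!: imageI)
    fix y assume "y \<in> carrier (D\<lparr>carrier := subgr W\<rparr>)"
    then obtain B where B: "finite B" "B \<subseteq> W" "y = \<phi> B" unfolding subgr_def by auto
    have AB: "finite (sym_diff A B)" "sym_diff A B \<subseteq> W" using A B by auto
    have "\<psi> (\<phi> A \<otimes>\<^bsub>D\<^esub> \<phi> B) = \<phi> (sym_diff (g ` A) (g ` B))"
      using A B \<psi>[OF AB] g_sd \<phi>_mult by simp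
    also have "\<dots> = \<psi> x \<otimes>\<^bsub>D\<^esub> \<psi> y" using A B \<psi> \<phi>_mult by simp
    finally show "\<psi> (x \<otimes>\<^bsub>D\<lparr>carrier := subgr W\<rparr>\<^esub> y) = \<psi> x \<otimes>\<^bsub>D\<lparr>carrier := subgr W'\<rparr>\<^esub> \<psi> y"
      using A B by simp
  qed
  moreover have "inj_on \<psi> (subgr W)"
  proof (rule inj_onI)
    fix x y assume "x \<in> subgr W" "y \<in> subgr W" and eq: "\<psi> x = \<psi> y"
    then obtain A B where AB: "finite A" "A \<subseteq> W" "x = \<phi> A" "finite B" "B \<subseteq> W" "y = \<phi> B"
      unfolding subgr_def by auto
    then have "g ` A = g ` B" using \<psi> eq \<phi>_inj by simp
    then show "x = y" using AB inj by (simp add: inj_on_image_eq_iff)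
  qed
  ultimately have "\<psi> \<in> isometric_group_embeddings (D\<lparr>carrier := subgr W\<rparr>) d (D\<lparr>carrier := subgr W'\<rparr>) d"
    using iso unfolding isometric_group_embeddings_def mon_def by (auto simp: subgr_def)
  then show ?thesis unfolding isometric_embeddability_def using subgr_in_Subg by blast
qed

text \<open>The norm of an element is its distance to the identity, so kinds are preserved. Kinds
  from 2 on single out the generators, which defines \<open>g\<close>; kind 1 turns the image of an
  edge into an edge, in an unknown direction.\<close>

lemma graph_map_if_embeddable:
  assumes "(subgr W, subgr W') \<in> isometric_embeddability D d"
  obtains g where "g ` W \<subseteq> W'" "\<And>v. v \<in> W \<Longrightarrow> c (g v) = c v"
    "\<And>v w. v \<in> W \<Longrightarrow> w \<in> W \<Longrightarrow> v \<noteq> w \<Longrightarrow> E v w \<Longrightarrow> E (g v) (g w) \<or> E (g w) (g v)"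
proof -
  obtain \<psi> where \<psi>: "\<psi> \<in> isometric_group_embeddings (D\<lparr>carrier := subgr W\<rparr>) d (D\<lparr>carrier := subgr W'\<rparr>) d"
    using assms unfolding isometric_embeddability_def by blast
  have mult: "\<psi> (x \<otimes>\<^bsub>D\<^esub> y) = \<psi> x \<otimes>\<^bsub>D\<^esub> \<psi> y" and iso: "d (\<psi> x) (\<psi> y) = d x y"
    if "x \<in> subgr W" "y \<in> subgr W" for x y
    using \<psi> that unfolding isometric_group_embeddings_def mon_def hom_def by auto
  have cl: "\<psi> x \<in> subgr W'" if "x \<in> subgr W" for x
    using \<psi> that unfolding isometric_group_embeddings_def mon_def hom_def by auto
  have sub: "\<phi> A \<in> subgr W" if "finite A" "A \<subseteq> W" for A using that unfolding subgr_def by blast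
  have "\<forall>A. finite A \<and> A \<subseteq> W \<longrightarrow> (\<exists>B. finite B \<and> B \<subseteq> W' \<and> \<psi> (\<phi> A) = \<phi> B)"
  proof (intro allI impI)
    fix A assume "finite A \<and> A \<subseteq> W"
    then have "\<psi> (\<phi> A) \<in> subgr W'" using cl sub by blast
    then show "\<exists>B. finite B \<and> B \<subseteq> W' \<and> \<psi> (\<phi> A) = \<phi> B" unfolding subgr_def by blast
  qed
  then obtain \<Psi> where \<Psi>: "\<And>A. finite A \<Longrightarrow> A \<subseteq> W \<Longrightarrow> finite (\<Psi> A) \<and> \<Psi> A \<subseteq> W' \<and> \<psi> (\<phi> A) = \<phi> (\<Psi> A)"
    by metis
  have sd: "\<Psi> (sym_diff A B) = sym_diff (\<Psi> A) (\<Psi> B)" if AB: "finite A" "A \<subseteq> W" "finite B" "B \<subseteq> W" for A B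
  proof (rule \<phi>_inj)
    have fin: "finite (sym_diff A B)" "sym_diff A B \<subseteq> W" using AB by auto
    show "finite (\<Psi> (sym_diff A B))" "finite (sym_diff (\<Psi> A) (\<Psi> B))" using \<Psi> AB fin by auto
    have "\<phi> (\<Psi> (sym_diff A B)) = \<psi> (\<phi> A \<otimes>\<^bsub>D\<^esub> \<phi> B)" using \<Psi>[OF fin] AB \<phi>_mult by simp
    also have "\<dots> = \<phi> (\<Psi> A) \<otimes>\<^bsub>D\<^esub> \<phi> (\<Psi> B)" using mult sub AB \<Psi> by simp
    also have "\<dots> = \<phi> (sym_diff (\<Psi> A) (\<Psi> B))" using \<Psi> AB \<phi>_mult by simp
    finally show "\<phi> (\<Psi> (sym_diff A B)) = \<phi> (sym_diff (\<Psi> A) (\<Psi> B))" .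
  qed
  have empty: "\<Psi> {} = {}" using sd[of "{}" "{}"] by simp
  have norm: "\<Psi> A \<noteq> {} \<and> kind c E (\<Psi> A) = kind c E A" if A: "finite A" "A \<subseteq> W" "A \<noteq> {}" for A
  proof -
    have "d (\<phi> (\<Psi> A)) (\<phi> (\<Psi> {})) = d (\<phi> A) (\<phi> {})" using iso[of "\<phi> A" "\<phi> {}"] sub A \<Psi> by simp
    then have "kind_norm K c E (\<Psi> A) = kind_norm K c E A"
      using A \<Psi> by (simp add: \<phi>_dist empty)
    then show ?thesis using kind_norm_eq_iff[OF K_pos, of c E "\<Psi> A" A] A(3) by simp
  qed
  have "\<exists>v'. \<Psi> {v} = {v'} \<and> c v' = c v" if "v \<in> W" for v
  proof -
    have k: "kind c E (\<Psi> {v}) = 2 + c v" using norm[of "{v}"] that by (simp add: kind_def)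
    then have "is_singleton (\<Psi> {v})" unfolding kind_def by (auto split: if_splits)
    then show ?thesis using k unfolding kind_def by (auto simp: is_singleton_def)
  qed
  then obtain g where g: "\<And>v. v \<in> W \<Longrightarrow> \<Psi> {v} = {g v} \<and> c (g v) = c v" by metis
  show thesis
  proof
    show "g ` W \<subseteq> W'" using g \<Psi> by (metis empty_subsetI finite.emptyI finite.insertI image_subsetI insert_subset)
    show "c (g v) = c v" if "v \<in> W" for v using g that by blast
    show "E (g v) (g w) \<or> E (g w) (g v)" if vw: "v \<in> W" "w \<in> W" "v \<noteq> w" "E v w" for v w
    proof -
      have eq: "\<Psi> {v, w} = sym_diff {g v} {g w}"
        using sd[of "{v}" "{w}"] vw g by (simp add: insert_Diff_if insert_commute)
      have "\<not> is_singleton {v, w}" using vw by (auto simp: is_singleton_def)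
      then have "kind c E {v, w} = 1" unfolding kind_def using vw by auto
      then have k: "kind c E (\<Psi> {v, w}) = 1" and "\<Psi> {v, w} \<noteq> {}" using norm[of "{v, w}"] vw by auto
      \<comment> \<open>If \<open>g v\<close> and \<open>g w\<close> coincided, the symmetric
        difference would be empty, contrary to \<open>norm\<close>.\<close>
      then have "\<Psi> {v, w} = {g v, g w}" using eq by auto
      moreover obtain v' w' where "E v' w'" "\<Psi> {v, w} = {v', w'}"
        using k unfolding kind_def by (auto split: if_splits)
      ultimately show ?thesis using doubleton_eq_iff by metis
    qed
  qed
qed

end

lemma (in universal_group) boolean_copy_exists:
  fixes c :: "'v::countable \<Rightarrow> nat"
  obtains \<phi> where "boolean_copy K D d \<phi> c E"
proof (rule boolean_group_embeds[where N = "kind_norm K c E", OF _ kind_norm_bounds(1)[OF K_pos] kind_norm_bounds(2)[OF K_pos]])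
  show "kind_norm K c E {} = 0" by (simp add: kind_norm_def)
  fix \<phi> assume \<phi>: "\<And>A. finite A \<Longrightarrow> \<phi> A \<in> carrier D"
    "\<And>A B. finite A \<Longrightarrow> finite B \<Longrightarrow> \<phi> (sym_diff A B) = \<phi> A \<otimes>\<^bsub>D\<^esub> \<phi> B"
    "\<And>A B. finite A \<Longrightarrow> finite B \<Longrightarrow> d (\<phi> A) (\<phi> B) = kind_norm K c E (sym_diff A B)"
  have "boolean_copy K D d \<phi> c E" by unfold_locales (fact \<phi>)+
  then show thesis by (rule that)
qed

section \<open>The Effros structure on closed subgroups\<close>

lemma le_if_le_plus_eps:
  fixes x y c :: real
  assumes "\<And>e. e > 0 \<Longrightarrow> x \<le> y + c * e" "c > 0"
  shows "x \<le> y"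
proof (rule field_le_epsilon)
  fix e :: real assume "e > 0"
  then show "x \<le> y + e" using assms(1)[of "e / c"] assms(2) by simp
qed

lemma inverse_pow2_tendsto: "(\<lambda>k. c / 2 ^ k :: real) \<longlonglongrightarrow> 0"
  using tendsto_mult[OF tendsto_const[of c] LIMSEQ_inverse_realpow_zero[of 2]]
  by (simp add: field_simps)

lemma second_countable_euclidean: "second_countable (euclidean :: 'z::second_countable_topology topology)"
proof -
  obtain B :: "'z set set" where B: "countable B" "\<And>C. C \<in> B \<Longrightarrow> open C" "\<And>S. open S \<Longrightarrow> \<exists>U. U \<subseteq> B \<and> S = \<Union>U"
    using univ_second_countable by metis
  have "\<exists>V\<in>B. x \<in> V \<and> V \<subseteq> S" if "open S" "x \<in> S" for x S
    using B(3)[OF that(1)] that(2) by blast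
  then show ?thesis unfolding second_countable_def using B(1,2) by (intro exI[of _ B]) auto
qed

section \<open>Fast limits and distance functions\<close>

context Metric_space
begin

lemma separable_dense_sequence:
  assumes "separable_space mtopology" "M \<noteq> {}"
  obtains q :: "nat \<Rightarrow> 'a" where "range q \<subseteq> M" "\<And>y e. y \<in> M \<Longrightarrow> e > 0 \<Longrightarrow> \<exists>n. d (q n) y < e"
proof -
  obtain C where C: "countable C" "C \<subseteq> M" "mtopology closure_of C = M"
    using assms(1) unfolding separable_space_def by auto
  then have "C \<noteq> {}" using assms(2) by auto
  show thesis
  proof
    show "range (from_nat_into C) \<subseteq> M" using C \<open>C \<noteq> {}\<close> by (simp add: range_from_nat_into)
    fix y :: 'a and e :: real assume "y \<in> M" "e > 0"
    then obtain x where "x \<in> C" "d y x < e" using C(3) unfolding metric_closure_of by auto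
    then show "\<exists>n. d (from_nat_into C n) y < e"
      using C(1) commute by (metis from_nat_into_surj)
  qed
qed

text \<open>The rate of convergence is kept explicit because later estimates need to know how far
  the limit lies from each term.\<close>

lemma fast_Cauchy_limit:
  fixes c :: real
  assumes mcomplete and s: "\<And>k. s k \<in> M" and step: "\<And>k. d (s k) (s (Suc k)) \<le> c / 2 ^ k"
  obtains x where "x \<in> M" "\<And>k. d (s k) x \<le> 2 * c / 2 ^ k"
proof -
  have c: "c \<ge> 0" using order_trans[OF nonneg step[of 0]] by simp
  have far: "d (s k) (s (k + m)) \<le> 2 * c / 2 ^ k" for k m
  proof -
    \<comment> \<open>The subtracted term is the unspent rest of the geometric series; it makes the
      induction go through.\<close>
    have "d (s k) (s (k + m)) \<le> 2 * c / 2 ^ k - 2 * c / 2 ^ (k + m)"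
    proof (induction m)
      case (Suc m)
      have "d (s k) (s (k + Suc m)) \<le> d (s k) (s (k + m)) + d (s (k + m)) (s (Suc (k + m)))"
        using triangle[OF s s s] by simp
      moreover have "2 * c / 2 ^ (k + Suc m) = c / 2 ^ (k + m)" "2 * c / 2 ^ (k + m) = 2 * (c / 2 ^ (k + m))"
        by simp_all
      ultimately show ?case using Suc step[of "k + m"] by linarith
    qed (use s in simp)
    also have "\<dots> \<le> 2 * c / 2 ^ k" using c by simp
    finally show ?thesis .
  qed
  have lim0: "(\<lambda>k. 4 * c / 2 ^ k) \<longlonglongrightarrow> 0"
    by (rule inverse_pow2_tendsto)
  have "MCauchy s"
    unfolding MCauchy_def
  proof (intro conjI allI impI)
    show "range s \<subseteq> M" using s by blast
    fix e :: real assume "e > 0"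
    then obtain k where k: "4 * c / 2 ^ k < e"
      using order_tendstoD(2)[OF lim0] by (auto simp: eventually_sequentially)
    have "d (s n) (s n') < e" if "k \<le> n" "k \<le> n'" for n n'
    proof -
      have "d (s n) (s n') \<le> d (s k) (s n) + d (s k) (s n')" using triangle''[OF s s s] commute by metis
      also have "\<dots> \<le> 2 * c / 2 ^ k + 2 * c / 2 ^ k"
        using far[of k "n - k"] far[of k "n' - k"] that by simp
      finally show ?thesis using k by simp
    qed
    then show "\<exists>N. \<forall>n n'. N \<le> n \<longrightarrow> N \<le> n' \<longrightarrow> d (s n) (s n') < e" by blast
  qed
  then obtain x where x: "limitin mtopology s x sequentially"
    using \<open>mcomplete\<close> unfolding mcomplete_def by blast
  then have xM: "x \<in> M" and lim: "(\<lambda>n. d (s n) x) \<longlonglongrightarrow> 0"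
    unfolding limitin_metric_dist_null by auto
  have "d (s k) x \<le> 2 * c / 2 ^ k" for k
  proof (rule tendsto_le[OF trivial_limit_sequentially _ tendsto_const])
    show "(\<lambda>n. 2 * c / 2 ^ k + d (s n) x) \<longlonglongrightarrow> 2 * c / 2 ^ k" using tendsto_add[OF tendsto_const lim] by simp
    have "d (s k) x \<le> 2 * c / 2 ^ k + d (s n) x" if "n \<ge> k" for n
      using triangle[OF s s xM, of k n] far[of k "n - k"] that by simp
    then show "\<forall>\<^sub>F n in sequentially. d (s k) x \<le> 2 * c / 2 ^ k + d (s n) x"
      unfolding eventually_sequentially by blast
  qed
  then show thesis using that xM by blast
qed

definition dist_to :: "'a set \<Rightarrow> 'a \<Rightarrow> real" where
  "dist_to H x = (INF h\<in>H. d x h)"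

lemma dist_to_less_iff: "H \<noteq> {} \<Longrightarrow> dist_to H x < r \<longleftrightarrow> (\<exists>h\<in>H. d x h < r)"
  unfolding dist_to_def by (rule cINF_less_iff) (auto intro!: bdd_belowI[of _ 0])

lemma dist_to_le: "h \<in> H \<Longrightarrow> dist_to H x \<le> d x h"
  unfolding dist_to_def by (rule cINF_lower) (auto intro!: bdd_belowI[of _ 0])

lemma dist_to_nonneg: "H \<noteq> {} \<Longrightarrow> 0 \<le> dist_to H x"
  using dist_to_less_iff[of H x 0] nonneg by (meson not_less)

lemma dist_to_near: 
  assumes "H \<noteq> {}" "e > 0" obtains h where "h \<in> H" "d x h < dist_to H x + e"
  using dist_to_less_iff[OF assms(1), of x "dist_to H x + e"] assms(2) by auto

lemma dist_to_lipschitz: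
  assumes "H \<noteq> {}" "H \<subseteq> M" "x \<in> M" "y \<in> M"
  shows "dist_to H x \<le> dist_to H y + d x y"
proof (rule field_le_epsilon)
  fix e :: real assume "e > 0"
  then obtain h where h: "h \<in> H" "d y h < dist_to H y + e" using dist_to_near assms(1) by blast
  have "dist_to H x \<le> d x h" using dist_to_le h by blast
  also have "\<dots> \<le> d x y + d y h" using triangle assms h by blast
  finally show "dist_to H x \<le> dist_to H y + d x y + e" using h by simp
qed

lemma dist_to_zero_imp_mem:
  assumes "closedin mtopology H" "H \<noteq> {}" "x \<in> M" "dist_to H x \<le> 0"
  shows "x \<in> H"
proof (rule ccontr)
  assume "x \<notin> H"
  then obtain r where r: "r > 0" "disjnt H (mball x r)"
    using assms unfolding closedin_metric by blast
  obtain h where "h \<in> H" "d x h < dist_to H x + r" using dist_to_near r(1) assms(2) by blast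
  then show False using r assms closedin_metric[of H] unfolding disjnt_iff by auto
qed

lemma tendsto_mdist:
  assumes "\<And>k. s k \<in> M" "\<And>k. t k \<in> M" "x \<in> M" "y \<in> M"
    and s: "(\<lambda>k. d (s k) x) \<longlonglongrightarrow> 0" and t: "(\<lambda>k. d (t k) y) \<longlonglongrightarrow> 0"
  shows "(\<lambda>k. d (s k) (t k)) \<longlonglongrightarrow> d x y"
proof (rule LIM_zero_cancel, rule Lim_null_comparison)
  have "\<bar>d (s k) (t k) - d x y\<bar> \<le> d (s k) x + d (t k) y" for k
    using triangle[of "s k" x "t k"] triangle[of x y "t k"] triangle[of x "s k" y] triangle[of "s k" "t k" y]
      commute[of "t k" y] commute[of "s k" x] assms(1-4) by fastforce
  then show "\<forall>\<^sub>F k in sequentially. norm (d (s k) (t k) - d x y) \<le> d (s k) x + d (t k) y" by simp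
  show "(\<lambda>k. d (s k) x + d (t k) y) \<longlonglongrightarrow> 0" using tendsto_add[OF s t] by simp
qed

end

context polish_group
begin

text \<open>The factors are changed one at a time, each at its own cost by bi-invariance. Together
  with \<open>d_inv\<close> this lets the subgroup axioms be written as inequalities for the
  distance function.\<close>

lemma d_mult_le:
  assumes "x \<in> carrier D" "y \<in> carrier D" "x' \<in> carrier D" "y' \<in> carrier D"
  shows "d (x \<otimes>\<^bsub>D\<^esub> y) (x' \<otimes>\<^bsub>D\<^esub> y') \<le> d x x' + d y y'"
  using triangle[of "x \<otimes>\<^bsub>D\<^esub> y" "x' \<otimes>\<^bsub>D\<^esub> y" "x' \<otimes>\<^bsub>D\<^esub> y'"] d_mult_left[of y y' x'] d_mult_right[of x x' y] assms
  by simp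

lemma d_inv:
  assumes "x \<in> carrier D" "y \<in> carrier D"
  shows "d (inv\<^bsub>D\<^esub> x) (inv\<^bsub>D\<^esub> y) = d x y"
proof -
  have "d (inv\<^bsub>D\<^esub> x) (inv\<^bsub>D\<^esub> y) = d (x \<otimes>\<^bsub>D\<^esub> inv\<^bsub>D\<^esub> x) (x \<otimes>\<^bsub>D\<^esub> inv\<^bsub>D\<^esub> y)"
    using d_mult_left[of "inv\<^bsub>D\<^esub> x" "inv\<^bsub>D\<^esub> y" x] assms by simp
  also have "\<dots> = d (x \<otimes>\<^bsub>D\<^esub> inv\<^bsub>D\<^esub> x \<otimes>\<^bsub>D\<^esub> y) (x \<otimes>\<^bsub>D\<^esub> inv\<^bsub>D\<^esub> y \<otimes>\<^bsub>D\<^esub> y)"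
    using d_mult_right[of "x \<otimes>\<^bsub>D\<^esub> inv\<^bsub>D\<^esub> x" "x \<otimes>\<^bsub>D\<^esub> inv\<^bsub>D\<^esub> y" y] assms by simp
  also have "\<dots> = d x y" using assms commute by (simp add: m_assoc)
  finally show ?thesis .
qed

lemma SubgD:
  assumes "H \<in> Subg D d"
  shows "subgroup H D" "closedin mtopology H" "H \<noteq> {}" "H \<subseteq> carrier D" "\<one>\<^bsub>D\<^esub> \<in> H"
  using assms unfolding Subg_def by (auto intro: subgroup.one_closed dest: subgroup.subset)

lemma dist_to_mult_le:
  assumes H: "H \<in> Subg D d" and xy: "x \<in> carrier D" "y \<in> carrier D"
  shows "dist_to H (x \<otimes>\<^bsub>D\<^esub> y) \<le> dist_to H x + dist_to H y"
proof (rule le_if_le_plus_eps[where c = 2])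
  fix e :: real assume "e > 0"
  then obtain h k where hk: "h \<in> H" "d x h < dist_to H x + e" "k \<in> H" "d y k < dist_to H y + e"
    using dist_to_near[OF SubgD(3)[OF H]] by metis
  have "dist_to H (x \<otimes>\<^bsub>D\<^esub> y) \<le> d (x \<otimes>\<^bsub>D\<^esub> y) (h \<otimes>\<^bsub>D\<^esub> k)"
    using hk SubgD(1)[OF H] by (intro dist_to_le) (simp add: subgroup.m_closed)
  also have "\<dots> \<le> d x h + d y k" using hk xy SubgD(4)[OF H] by (intro d_mult_le) auto
  finally show "dist_to H (x \<otimes>\<^bsub>D\<^esub> y) \<le> dist_to H x + dist_to H y + 2 * e" using hk by simp
qed simp

lemma dist_to_inv_le:
  assumes H: "H \<in> Subg D d" and x: "x \<in> carrier D"
  shows "dist_to H (inv\<^bsub>D\<^esub> x) \<le> dist_to H x"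
proof (rule field_le_epsilon)
  fix e :: real assume "e > 0"
  then obtain h where h: "h \<in> H" "d x h < dist_to H x + e"
    using dist_to_near[OF SubgD(3)[OF H]] by metis
  have "dist_to H (inv\<^bsub>D\<^esub> x) \<le> d (inv\<^bsub>D\<^esub> x) (inv\<^bsub>D\<^esub> h)"
    using h SubgD(1)[OF H] by (intro dist_to_le) (simp add: subgroup.m_inv_closed)
  also have "\<dots> = d x h" using h x SubgD(4)[OF H] by (intro d_inv) auto
  finally show "dist_to H (inv\<^bsub>D\<^esub> x) \<le> dist_to H x + e" using h by simp
qed

end

section \<open>Codes of closed subgroups\<close>

locale dense_polish_group = polish_group K D d
  for K :: real and D :: "'g monoid" and d :: "'g \<Rightarrow> 'g \<Rightarrow> real" +
  fixes q :: "nat \<Rightarrow> 'g"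
  assumes q_closed: "q n \<in> carrier D"
    and q_dense: "y \<in> carrier D \<Longrightarrow> e > 0 \<Longrightarrow> \<exists>n. d (q n) y < e"
begin

definition \<Phi> :: "'g set \<Rightarrow> nat \<Rightarrow> real" where
  "\<Phi> H n = dist_to H (q n)"

text \<open>Besides positivity and the Lipschitz condition, the clauses say that the zero set
  contains the identity, inverses and products. The dense sequence need not be closed under the
  operations, so an inverse or product enters through the nearby \<open>q k\<close>.\<close>

definition closed_codes :: "(nat \<Rightarrow> real) set" where
  "closed_codes = {r. (\<forall>n. 0 \<le> r n) \<and> (\<forall>n. r n \<le> d (q n) \<one>\<^bsub>D\<^esub>) \<and>
     (\<forall>k n. r k \<le> r n + d (q k) (q n)) \<and>
     (\<forall>k n. r k \<le> r n + d (q k) (inv\<^bsub>D\<^esub> (q n))) \<and>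
     (\<forall>k n m. r k \<le> r n + r m + d (q k) (q n \<otimes>\<^bsub>D\<^esub> q m))}"

text \<open>A function satisfying the Lipschitz condition is the distance function of its zero set
  once near-zeros can be found at almost the prescribed distance; by completeness, iterating this
  condition produces a true zero.\<close>

definition codes :: "(nat \<Rightarrow> real) set" where
  "codes = closed_codes \<inter>
     {r. \<forall>n j. \<exists>m. d (q n) (q m) < r n + 1 / real (Suc j) \<and> r m < 1 / real (Suc j)}"

lemma \<Phi>_in_codes:
  assumes H: "H \<in> Subg D d"
  shows "\<Phi> H \<in> codes"
proof -
  note H' = SubgD[OF H]
  have "\<Phi> H n \<le> d (q n) \<one>\<^bsub>D\<^esub>" for n unfolding \<Phi>_def using dist_to_le H' by simp
  moreover have "\<Phi> H k \<le> \<Phi> H n + d (q k) (q n)" for k n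
    unfolding \<Phi>_def using dist_to_lipschitz H' q_closed by simp
  moreover have "\<Phi> H k \<le> \<Phi> H n + d (q k) (inv\<^bsub>D\<^esub> (q n))" for k n
    unfolding \<Phi>_def using dist_to_lipschitz[of H "q k" "inv\<^bsub>D\<^esub> (q n)"] dist_to_inv_le[OF H, of "q n"] H' q_closed by simp
  moreover have "\<Phi> H k \<le> \<Phi> H n + \<Phi> H m + d (q k) (q n \<otimes>\<^bsub>D\<^esub> q m)" for k n m
    unfolding \<Phi>_def using dist_to_lipschitz[of H "q k" "q n \<otimes>\<^bsub>D\<^esub> q m"] dist_to_mult_le[OF H, of "q n" "q m"] H' q_closed by simp
  moreover have "\<exists>m. d (q n) (q m) < \<Phi> H n + 1 / real (Suc j) \<and> \<Phi> H m < 1 / real (Suc j)" for n j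
  proof -
    define e where "e = 1 / real (Suc j) / 2"
    have e: "e > 0" "1 / real (Suc j) = 2 * e" unfolding e_def by (simp_all add: field_simps)
    obtain h where h: "h \<in> H" "d (q n) h < \<Phi> H n + e"
      unfolding \<Phi>_def using dist_to_near H'(3) e by blast
    then obtain m where m: "d (q m) h < e" using q_dense e H' by blast
    have "d (q n) (q m) \<le> d (q n) h + d (q m) h" using triangle'' q_closed h H' commute by (metis subsetD)
    moreover have "\<Phi> H m \<le> d (q m) h" unfolding \<Phi>_def using dist_to_le h by blast
    ultimately show ?thesis using h m e(1) unfolding e(2) by (intro exI[of _ m]) auto
  qed
  ultimately show ?thesis
    unfolding codes_def closed_codes_def using dist_to_nonneg[OF H'(3)] by (auto simp: \<Phi>_def)
qed

text \<open>For Lipschitz \<open>r\<close> this is the zero set of the continuous extension of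
  \<open>r\<close> from the dense sequence to the whole group.\<close>

definition decode :: "(nat \<Rightarrow> real) \<Rightarrow> 'g set" where
  "decode r = {x \<in> carrier D. \<forall>e>0. \<exists>n. d x (q n) < e \<and> r n < e}"

lemma decode_Subg:
  assumes "r \<in> codes"
  shows "decode r \<in> Subg D d"
proof -
  have one: "r n \<le> d (q n) \<one>\<^bsub>D\<^esub>" and inv: "r k \<le> r n + d (q k) (inv\<^bsub>D\<^esub> (q n))"
    and mult: "r k \<le> r n + r m + d (q k) (q n \<otimes>\<^bsub>D\<^esub> q m)" for k n m
    using assms unfolding codes_def closed_codes_def by auto
  have "subgroup (decode r) D"
  proof
    show sub: "decode r \<subseteq> carrier D" unfolding decode_def by blast
    show "\<one>\<^bsub>D\<^esub> \<in> decode r"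
      unfolding decode_def using q_dense[of "\<one>\<^bsub>D\<^esub>"] one commute by (fastforce intro: le_less_trans)
    show "x \<otimes>\<^bsub>D\<^esub> y \<in> decode r" if xy: "x \<in> decode r" "y \<in> decode r" for x y
      unfolding decode_def
    proof (intro CollectI conjI allI impI)
      have car: "x \<in> carrier D" "y \<in> carrier D" using xy sub by auto
      then show "x \<otimes>\<^bsub>D\<^esub> y \<in> carrier D" by simp
      fix e :: real assume "e > 0"
      then have e: "e / 3 > 0" by simp
      obtain n where n: "d x (q n) < e / 3" "r n < e / 3" using xy e unfolding decode_def by blast
      obtain m where m: "d y (q m) < e / 3" "r m < e / 3" using xy e unfolding decode_def by blast
      obtain k where k: "d (q k) (q n \<otimes>\<^bsub>D\<^esub> q m) < e / 3" using q_dense[OF _ e] q_closed by blast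
      have "d (x \<otimes>\<^bsub>D\<^esub> y) (q k) \<le> d (x \<otimes>\<^bsub>D\<^esub> y) (q n \<otimes>\<^bsub>D\<^esub> q m) + d (q n \<otimes>\<^bsub>D\<^esub> q m) (q k)"
        using triangle car q_closed by simp
      also have "\<dots> \<le> d x (q n) + d y (q m) + d (q k) (q n \<otimes>\<^bsub>D\<^esub> q m)"
        using d_mult_le[of x y "q n" "q m"] car q_closed commute by simp
      finally show "\<exists>k. d (x \<otimes>\<^bsub>D\<^esub> y) (q k) < e \<and> r k < e"
        using n m k mult[of k n m] by (intro exI[of _ k]) auto
    qed
    show "inv\<^bsub>D\<^esub> x \<in> decode r" if x: "x \<in> decode r" for x
      unfolding decode_def
    proof (intro CollectI conjI allI impI)
      have car: "x \<in> carrier D" using x sub by auto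
      then show "inv\<^bsub>D\<^esub> x \<in> carrier D" by simp
      fix e :: real assume "e > 0"
      then have e: "e / 2 > 0" by simp
      obtain n where n: "d x (q n) < e / 2" "r n < e / 2" using x e unfolding decode_def by blast
      obtain k where k: "d (q k) (inv\<^bsub>D\<^esub> (q n)) < e / 2" using q_dense[OF _ e] q_closed by blast
      have "d (inv\<^bsub>D\<^esub> x) (q k) \<le> d (inv\<^bsub>D\<^esub> x) (inv\<^bsub>D\<^esub> (q n)) + d (inv\<^bsub>D\<^esub> (q n)) (q k)"
        using triangle car q_closed by simp
      also have "\<dots> = d x (q n) + d (q k) (inv\<^bsub>D\<^esub> (q n))"
        using d_inv[of x "q n"] car q_closed commute by simp
      finally show "\<exists>k. d (inv\<^bsub>D\<^esub> x) (q k) < e \<and> r k < e"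
        using n k inv[of k n] by (intro exI[of _ k]) auto
    qed
  qed
  moreover have "closedin mtopology (decode r)"
    unfolding closedin_metric
  proof (intro conjI allI impI)
    show "decode r \<subseteq> carrier D" unfolding decode_def by blast
    fix x assume x: "x \<in> carrier D - decode r"
    then obtain e where e: "e > 0" "\<And>n. \<not> (d x (q n) < e \<and> r n < e)" unfolding decode_def by blast
    have "disjnt (decode r) (mball x (e / 2))"
      unfolding disjnt_iff
    proof (intro allI notI, elim conjE)
      fix y assume y: "y \<in> decode r" "y \<in> mball x (e / 2)"
      then obtain n where n: "d y (q n) < e / 2" "r n < e / 2" using e half_gt_zero unfolding decode_def by blast
      have "d x (q n) \<le> d x y + d y (q n)" using triangle x y q_closed by auto
      also have "\<dots> < e" using n y by simp
      finally show False using e(1) e(2)[of n] n by simp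
    qed
    then show "\<exists>r'>0. disjnt (decode r) (mball x r')" using e by (intro exI[of _ "e / 2"]) auto
  qed
  ultimately show ?thesis unfolding Subg_def by blast
qed

text \<open>The Lipschitz condition keeps the zero set at distance at least \<open>r n\<close> from
  \<open>q n\<close>. The converse bound needs an actual zero at distance at most
  \<open>r n + e\<close>, which is built as a limit of near-zeros.\<close>

lemma \<Phi>_decode:
  assumes "r \<in> codes"
  shows "\<Phi> (decode r) = r"
proof
  fix n
  have lip: "r k \<le> r n + d (q k) (q n)" for k n
    using assms unfolding codes_def closed_codes_def by auto
  have near: "\<exists>m. d (q n) (q m) < r n + e \<and> r m < e" if e: "e > 0" for n e
  proof -
    obtain j where j: "inverse (real (Suc j)) < e" using reals_Archimedean[OF e] by blast
    obtain m where "d (q n) (q m) < r n + 1 / real (Suc j)" "r m < 1 / real (Suc j)"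
      using assms unfolding codes_def by blast
    then show ?thesis using j by (intro exI[of _ m]) (auto simp: inverse_eq_divide)
  qed
  have ne: "decode r \<noteq> {}" and sub: "decode r \<subseteq> carrier D" using SubgD[OF decode_Subg[OF assms]] by auto
  have "r n \<le> d (q n) h" if h: "h \<in> decode r" for h
  proof (rule le_if_le_plus_eps[where c = 2])
    fix e :: real assume "e > 0"
    then obtain m where m: "d h (q m) < e" "r m < e" using h unfolding decode_def by blast
    have "r n \<le> r m + d (q n) (q m)" by (rule lip)
    also have "d (q n) (q m) \<le> d (q n) h + d h (q m)" using triangle q_closed h sub by blast
    finally show "r n \<le> d (q n) h + 2 * e" using m by simp
  qed simp
  then have ge: "r n \<le> \<Phi> (decode r) n" unfolding \<Phi>_def dist_to_def using ne by (intro cINF_greatest)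
  have "\<Phi> (decode r) n \<le> r n"
  proof (rule field_le_epsilon)
    fix e :: real assume e: "e > 0"
    \<comment> \<open>Chosen so that the total is e: the first jump exceeds \<open>r n\<close> by at
      most e/4, and the later ones, bounded by \<open>c k + c (Suc k)\<close>, sum to at most
      3e/4.\<close>
    define c where "c k = e / 4 / 2 ^ k" for k :: nat
    have c: "c k > 0" for k unfolding c_def using e by simp
    \<comment> \<open>Each near-zero is followed by a better one, and \<open>r (s k) < c k\<close>
      makes the jump to it short as well.\<close>
    define s where "s = rec_nat (SOME m. d (q n) (q m) < r n + c 0 \<and> r m < c 0)
      (\<lambda>k i. SOME m. d (q i) (q m) < r i + c (Suc k) \<and> r m < c (Suc k))"
    have s0: "d (q n) (q (s 0)) < r n + c 0 \<and> r (s 0) < c 0"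
      unfolding s_def using someI_ex[OF near[OF c]] by simp
    have sS: "d (q (s k)) (q (s (Suc k))) < r (s k) + c (Suc k) \<and> r (s (Suc k)) < c (Suc k)" for k
      unfolding s_def using someI_ex[OF near[OF c]] by simp
    have rs: "r (s k) < c k" for k using s0 sS by (cases k) auto
    have step: "d (q (s k)) (q (s (Suc k))) \<le> (3 * e / 8) / 2 ^ k" for k
    proof -
      have "d (q (s k)) (q (s (Suc k))) \<le> c k + c (Suc k)" using sS[of k] rs[of k] by simp
      also have "\<dots> = (3 * e / 8) / 2 ^ k" unfolding c_def by (simp add: field_simps)
      finally show ?thesis .
    qed
    obtain x where x: "x \<in> carrier D" "\<And>k. d (q (s k)) x \<le> 2 * (3 * e / 8) / 2 ^ k"
      using fast_Cauchy_limit[OF complete _ step] q_closed by blast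
    have "x \<in> decode r"
      unfolding decode_def
    proof (intro CollectI conjI allI impI)
      fix \<epsilon> :: real assume \<epsilon>: "\<epsilon> > 0"
      obtain k where k: "e / 2 ^ k < \<epsilon>"
      proof -
        have "(\<lambda>k. e / 2 ^ k) \<longlonglongrightarrow> 0" by (rule inverse_pow2_tendsto)
        then show thesis using order_tendstoD(2)[OF _ \<epsilon>] that by (force simp: eventually_sequentially)
      qed
      have "c k \<le> e / 2 ^ k" "2 * (3 * e / 8) / 2 ^ k \<le> e / 2 ^ k"
        using e unfolding c_def by (auto simp: field_simps)
      then show "\<exists>n. d x (q n) < \<epsilon> \<and> r n < \<epsilon>"
        using k rs[of k] x(2)[of k] commute[of x "q (s k)"] by (intro exI[of _ "s k"]) auto
    qed (rule x)
    then have "\<Phi> (decode r) n \<le> d (q n) x" unfolding \<Phi>_def by (rule dist_to_le)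
    also have "\<dots> \<le> d (q n) (q (s 0)) + d (q (s 0)) x" using triangle q_closed x by blast
    also have "\<dots> \<le> r n + c 0 + 2 * (3 * e / 8) / 2 ^ 0" using s0 x(2)[of 0] by (intro add_mono) auto
    also have "\<dots> = r n + e" unfolding c_def by simp
    finally show "\<Phi> (decode r) n \<le> r n + e" .
  qed
  then show "\<Phi> (decode r) n = r n" using ge by simp
qed

lemma decode_\<Phi>:
  assumes H: "H \<in> Subg D d"
  shows "decode (\<Phi> H) = H"
proof
  note H' = SubgD[OF H]
  show "H \<subseteq> decode (\<Phi> H)"
  proof
    fix h assume h: "h \<in> H"
    show "h \<in> decode (\<Phi> H)"
      unfolding decode_def
    proof (intro CollectI conjI allI impI)
      show "h \<in> carrier D" using h H' by blast
      fix e :: real assume "e > 0"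
      then obtain n where n: "d (q n) h < e" using q_dense h H' by blast
      then show "\<exists>n. d h (q n) < e \<and> \<Phi> H n < e"
        unfolding \<Phi>_def using dist_to_le[OF h, of "q n"] commute by (intro exI[of _ n]) auto
    qed
  qed
  show "decode (\<Phi> H) \<subseteq> H"
  proof
    fix x assume x: "x \<in> decode (\<Phi> H)"
    then have xD: "x \<in> carrier D" unfolding decode_def by blast
    have "dist_to H x \<le> 0"
    proof (rule le_if_le_plus_eps[where c = 2])
      fix e :: real assume "e > 0"
      then obtain n where "d x (q n) < e" "\<Phi> H n < e" using x unfolding decode_def by blast
      then show "dist_to H x \<le> 0 + 2 * e"
        using dist_to_lipschitz[of H x "q n"] H' xD q_closed unfolding \<Phi>_def by auto
    qed simp
    then show "x \<in> H" using dist_to_zero_imp_mem H' xD by blast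
  qed
qed

lemma closed_closed_codes: "closed closed_codes"
proof -
  have "closed_codes = (\<Inter>n. {r. 0 \<le> r n}) \<inter> (\<Inter>n. {r. r n \<le> d (q n) \<one>\<^bsub>D\<^esub>}) \<inter>
     (\<Inter>k n. {r. r k \<le> r n + d (q k) (q n)}) \<inter>
     (\<Inter>k n. {r. r k \<le> r n + d (q k) (inv\<^bsub>D\<^esub> (q n))}) \<inter>
     (\<Inter>k n m. {r. r k \<le> r n + r m + d (q k) (q n \<otimes>\<^bsub>D\<^esub> q m)})"
    unfolding closed_codes_def by auto
  also have "closed \<dots>"
    by (intro closed_Int closed_INT ballI closed_Collect_le continuous_intros continuous_on_product_coordinates)
  finally show ?thesis .
qed

lemma gdelta_codes: "gdelta_in euclidean codes"
proof -
  define U where "U n j = {r. \<exists>m. d (q n) (q m) < r n + 1 / real (Suc j) \<and> r m < 1 / real (Suc j)}" for n j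
  have U: "open (U n j)" for n j
    unfolding U_def
    by (intro open_Collect_ex open_Collect_conj open_Collect_less continuous_intros continuous_on_product_coordinates)
  have "gdelta_in euclidean closed_codes"
    using closed_closed_codes by (intro closed_imp_gdelta_in) (auto simp: metrizable_space_euclidean)
  moreover have "gdelta_in euclidean (\<Inter>(n, j)\<in>UNIV. U n j)"
    using U by (intro gdelta_in_Inter) (auto intro!: open_imp_gdelta_in)
  moreover have "codes = closed_codes \<inter> (\<Inter>(n, j)\<in>UNIV. U n j)"
    unfolding codes_def U_def by auto
  ultimately show ?thesis using gdelta_in_Int by metis
qed

text \<open>The Wijsman topology: distance functions are 1-Lipschitz, so continuity of the distances
  at the dense points \<open>q n\<close> amounts to continuity of the distances at all
  points.\<close>

definition Subg_topology :: "'g set topology" where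
  "Subg_topology = pullback_topology (Subg D d) \<Phi> euclidean"

lemma topspace_Subg_topology: "topspace Subg_topology = Subg D d"
  unfolding Subg_topology_def topspace_pullback_topology by simp

lemma polish_Subg_topology: "polish_topology Subg_topology"
proof -
  have "homeomorphic_maps Subg_topology (top_of_set codes) \<Phi> decode"
    unfolding homeomorphic_maps_def
  proof (intro conjI)
    show "continuous_map Subg_topology (top_of_set codes) \<Phi>"
      using continuous_map_pullback[of euclidean euclidean id "Subg D d" \<Phi>] \<Phi>_in_codes
      by (auto simp: continuous_map_in_subtopology topspace_Subg_topology Subg_topology_def[symmetric])
    show "continuous_map (top_of_set codes) Subg_topology decode"
      unfolding Subg_topology_def
    proof (rule continuous_map_pullback')
      have "continuous_map (top_of_set codes) euclidean id" by simp
      then show "continuous_map (top_of_set codes) euclidean (\<Phi> \<circ> decode)"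
        by (rule continuous_map_eq) (simp add: \<Phi>_decode)
      show "topspace (top_of_set codes) \<subseteq> decode -` Subg D d" using decode_Subg by auto
    qed
  qed (auto simp: topspace_Subg_topology decode_\<Phi> \<Phi>_decode)
  then have hom: "Subg_topology homeomorphic_space top_of_set codes"
    unfolding homeomorphic_space_def by blast
  have "completely_metrizable_space (top_of_set codes)"
    using completely_metrizable_space_gdelta_in gdelta_codes completely_metrizable_space_euclidean by blast
  moreover have "separable_space (top_of_set codes)"
    by (intro second_countable_imp_separable_space second_countable_subtopology second_countable_euclidean)
  ultimately show ?thesis
    unfolding polish_topology_def
    using homeomorphic_completely_metrizable_space[OF hom] homeomorphic_separable_space[OF hom] by blast
qed

lemma space_Subg_space: "space (Subg_space D d) = Subg D d"
  unfolding Subg_space_def space_restrict_space effros_borel_def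
  by (subst space_measure_of) (auto simp: Subg_def)

lemma hits_measurable:
  assumes "openin mtopology U"
  shows "{H \<in> Subg D d. H \<inter> U \<noteq> {}} \<in> sets (Subg_space D d)"
proof -
  have "{F. closedin mtopology F \<and> F \<inter> U \<noteq> {}} \<in> sets (effros_borel mtopology)"
    unfolding effros_borel_def using assms by (subst sets_measure_of) auto
  moreover have "{H \<in> Subg D d. H \<inter> U \<noteq> {}} = Subg D d \<inter> {F. closedin mtopology F \<and> F \<inter> U \<noteq> {}}"
    unfolding Subg_def by blast
  ultimately show ?thesis unfolding Subg_space_def sets_restrict_space by blast
qed

lemma dist_to_measurable:
  assumes "x \<in> carrier D"
  shows "(\<lambda>H. dist_to H x) \<in> borel_measurable (Subg_space D d)"
  unfolding borel_measurable_iff_less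
proof
  fix a
  have "{H \<in> space (Subg_space D d). dist_to H x < a} = {H \<in> Subg D d. H \<inter> mball x a \<noteq> {}}"
    unfolding space_Subg_space
  proof (intro Collect_cong conj_cong refl)
    fix H assume "H \<in> Subg D d"
    then show "dist_to H x < a \<longleftrightarrow> H \<inter> mball x a \<noteq> {}"
      using dist_to_less_iff[of H x a] SubgD(3,4)[of H] assms by (auto simp: mball_def)
  qed
  then show "{H \<in> space (Subg_space D d). dist_to H x < a} \<in> sets (Subg_space D d)"
    using hits_measurable by simp
qed

lemma \<Phi>_measurable: "\<Phi> \<in> borel_measurable (Subg_space D d)"
  by (rule measurable_coordinatewise_then_product) (simp add: \<Phi>_def dist_to_measurable q_closed)

text \<open>Measurability of \<open>\<Phi>\<close> yields one inclusion. For the other,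
  \<open>H\<close> meets \<open>U\<close> iff \<open>\<Phi> H n < e\<close> for some ball of radius
  \<open>e\<close> about \<open>q n\<close> inside \<open>U\<close>, an open condition on the
  code.\<close>

lemma standard_borel_Subg: "standard_borel_space (Subg_space D d)"
proof -
  let ?O = "{U. openin Subg_topology U}"
  have O: "?O \<subseteq> Pow (Subg D d)"
    using openin_subset topspace_Subg_topology by blast
  define B where "B = sigma (Subg D d) ?O"
  have B: "space B = Subg D d" "sets B = sigma_sets (Subg D d) ?O"
    unfolding B_def using O by (simp_all add: space_measure_of sets_measure_of)
  have "sigma_sets (Subg D d) ?O \<subseteq> sets (Subg_space D d)"
  proof -
    have "?O \<subseteq> sets (Subg_space D d)"
    proof
      fix U assume "U \<in> ?O"
      then obtain V where "open V" "U = \<Phi> -` V \<inter> Subg D d"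
        unfolding Subg_topology_def openin_pullback_topology by auto
      then show "U \<in> sets (Subg_space D d)"
        using measurable_sets[OF \<Phi>_measurable, of V] by (simp add: space_Subg_space)
    qed
    then show ?thesis using sets.sigma_sets_subset[of ?O "Subg_space D d"] unfolding space_Subg_space by blast
  qed
  moreover have "sets (Subg_space D d) \<subseteq> sets B"
  proof -
    have "id \<in> measurable B (Subg_space D d)"
      unfolding Subg_space_def
    proof (rule measurable_restrict_space2)
      show "id \<in> space B \<rightarrow> Subg D d" using B by simp
      show "id \<in> measurable B (effros_borel mtopology)"
        unfolding effros_borel_def
      proof (rule measurable_measure_of)
        show "{{F. closedin mtopology F \<and> F \<inter> U \<noteq> {}} |U. openin mtopology U} \<subseteq> Pow {F. closedin mtopology F}"
          by blast
        show "id \<in> space B \<rightarrow> {F. closedin mtopology F}" unfolding B Subg_def by auto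
        fix y assume "y \<in> {{F. closedin mtopology F \<and> F \<inter> U \<noteq> {}} |U. openin mtopology U}"
        then obtain U where U: "openin mtopology U" "y = {F. closedin mtopology F \<and> F \<inter> U \<noteq> {}}" by blast
        define J where "J = {(n, e). e > 0 \<and> mball (q n) e \<subseteq> U}"
        define V where "V = (\<Union>(n, e)\<in>J. {r :: nat \<Rightarrow> real. r n < e})"
        have "open V" unfolding V_def
          by (intro open_UN ballI) (auto intro!: open_Collect_less continuous_on_product_coordinates continuous_on_const)
        have "H \<inter> U \<noteq> {} \<longleftrightarrow> \<Phi> H \<in> V" if H: "H \<in> Subg D d" for H
        proof
          note H' = SubgD[OF H]
          assume "H \<inter> U \<noteq> {}"
          then obtain h where h: "h \<in> H" "h \<in> U" by blast
          then obtain e where e: "e > 0" "mball h e \<subseteq> U" using U(1) unfolding openin_mtopology by blast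
          \<comment> \<open>With radius e/2 the ball about \<open>q n\<close> stays inside
            \<open>mball h e\<close> and still reaches \<open>h\<close>.\<close>
          then obtain n where n: "d (q n) h < e / 2" using q_dense[of h "e / 2"] h H' by auto
          have "mball (q n) (e / 2) \<subseteq> mball h e"
          proof
            fix y assume y: "y \<in> mball (q n) (e / 2)"
            then have "d h y \<le> d (q n) h + d (q n) y"
              using triangle[of h "q n" y] commute h H' q_closed by auto
            then show "y \<in> mball h e" using y n h H' by auto
          qed
          then have "(n, e / 2) \<in> J" unfolding J_def using e by auto
          moreover have "\<Phi> H n < e / 2" unfolding \<Phi>_def using dist_to_le[OF h(1), of "q n"] n by simp
          ultimately show "\<Phi> H \<in> V" unfolding V_def by blast
        next
          assume "\<Phi> H \<in> V"
          then obtain n e where ne: "mball (q n) e \<subseteq> U" "\<Phi> H n < e" unfolding V_def J_def by blast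
          then obtain h where "h \<in> H" "d (q n) h < e" unfolding \<Phi>_def using dist_to_less_iff SubgD[OF H] by blast
          then have "h \<in> H \<inter> mball (q n) e" using q_closed SubgD(4)[OF H] by auto
          then show "H \<inter> U \<noteq> {}" using ne by blast
        qed
        then have "id -` y \<inter> space B = \<Phi> -` V \<inter> Subg D d"
          unfolding B U(2) using SubgD(2) by auto
        moreover have "\<Phi> -` V \<inter> Subg D d \<in> ?O"
          unfolding Subg_topology_def openin_pullback_topology using \<open>open V\<close> by auto
        ultimately show "id -` y \<inter> space B \<in> sets B" unfolding B by auto
      qed
    qed
    then have "id -` A \<inter> space B \<in> sets B" if "A \<in> sets (Subg_space D d)" for A
      using that measurable_sets by blast
    moreover have "id -` A \<inter> space B = A" if "A \<in> sets (Subg_space D d)" for A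
      using sets.sets_into_space[OF that] B(1) space_Subg_space by auto
    ultimately show ?thesis by auto
  qed
  ultimately have "sets (Subg_space D d) = sigma_sets (Subg D d) ?O" unfolding B by blast
  then show ?thesis
    unfolding standard_borel_space_def
    using polish_Subg_topology topspace_Subg_topology space_Subg_space by (intro exI[of _ Subg_topology]) simp
qed

end

section \<open>Analyticity of isometric embeddability\<close>

text \<open>The partial isometry from \<open>a n\<close> to \<open>b n\<close> is extended by
  completeness. Products are tested through distances, since a product of two terms need not be a
  term.\<close>

lemma (in polish_group) embeddable_if_dense_sequences:
  assumes H: "H \<in> Subg D d" and H': "H' \<in> Subg D d"
    and a: "\<And>n. a n \<in> H" and b: "\<And>n. b n \<in> H'"
    and dense: "\<And>h e. h \<in> H \<Longrightarrow> e > 0 \<Longrightarrow> \<exists>n. d h (a n) < e"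
    and iso: "\<And>n m. d (b n) (b m) = d (a n) (a m)"
    and mult: "\<And>n m l. d (b n \<otimes>\<^bsub>D\<^esub> b m) (b l) = d (a n \<otimes>\<^bsub>D\<^esub> a m) (a l)"
  shows "(H, H') \<in> isometric_embeddability D d"
proof -
  have inD: "\<And>h. h \<in> H \<Longrightarrow> h \<in> carrier D" "\<And>h. h \<in> H' \<Longrightarrow> h \<in> carrier D"
    using SubgD(4) H H' by auto
  have aD: "a n \<in> carrier D" and bD: "b n \<in> carrier D" for n using a b inD by auto
  \<comment> \<open>Prescribing the distances to all \<open>b n\<close> describes the image of
    \<open>h\<close> without reference to an approximating sequence.\<close>
  have "\<exists>y\<in>H'. \<forall>n. d (b n) y = d (a n) h" if h: "h \<in> H" for h
  proof -
    have "\<forall>k. \<exists>n. d h (a n) < 1 / 2 ^ k" using dense[OF h] by simp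
    then obtain \<nu> where \<nu>: "\<And>k::nat. d h (a (\<nu> k)) < 1 / 2 ^ k" by metis
    have step: "d (b (\<nu> k)) (b (\<nu> (Suc k))) \<le> 2 / 2 ^ k" for k
    proof -
      have "d (b (\<nu> k)) (b (\<nu> (Suc k))) = d (a (\<nu> k)) (a (\<nu> (Suc k)))" by (rule iso)
      also have "\<dots> \<le> d h (a (\<nu> k)) + d h (a (\<nu> (Suc k)))"
        using triangle[of "a (\<nu> k)" h "a (\<nu> (Suc k))"] commute aD inD(1)[OF h] by simp
      also have "\<dots> \<le> 1 / 2 ^ k + 1 / 2 ^ Suc k" using \<nu>[of k] \<nu>[of "Suc k"] by simp
      also have "\<dots> \<le> 2 / 2 ^ k" by (simp add: field_simps)
      finally show ?thesis .
    qed
    obtain y where y: "y \<in> carrier D" "\<And>k. d (b (\<nu> k)) y \<le> 2 * 2 / 2 ^ k"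
      using fast_Cauchy_limit[OF complete _ step] bD by blast
    have small: "\<exists>k. 1 / 2 ^ k < e" if "e > 0" for e :: real
      using real_arch_pow_inv[of e "1 / 2"] that by (simp add: power_one_over)
    have "d (b n) y = d (a n) h" for n
    proof (rule antisym)
      \<comment> \<open>The constant 5 is 1 for the distance from \<open>h\<close> to
        \<open>a (\<nu> k)\<close> plus 4 for that from \<open>y\<close> to
        \<open>b (\<nu> k)\<close>.\<close>
      show "d (b n) y \<le> d (a n) h"
      proof (rule le_if_le_plus_eps[where c = 5])
        fix e :: real assume "e > 0"
        then obtain k where k: "1 / 2 ^ k < e" using small by blast
        have "d (b n) y \<le> d (b n) (b (\<nu> k)) + d (b (\<nu> k)) y" using triangle bD y by blast
        moreover have "d (b n) (b (\<nu> k)) \<le> d (a n) h + d h (a (\<nu> k))"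
          unfolding iso using triangle aD inD(1)[OF h] by blast
        ultimately show "d (b n) y \<le> d (a n) h + 5 * e" using \<nu>[of k] y(2)[of k] k by simp
      qed simp
      show "d (a n) h \<le> d (b n) y"
      proof (rule le_if_le_plus_eps[where c = 5])
        fix e :: real assume "e > 0"
        then obtain k where k: "1 / 2 ^ k < e" using small by blast
        have "d (a n) h \<le> d (a n) (a (\<nu> k)) + d (a (\<nu> k)) h" using triangle aD inD(1)[OF h] by blast
        moreover have "d (a n) (a (\<nu> k)) \<le> d (b n) y + d y (b (\<nu> k))"
          unfolding iso[symmetric] using triangle bD y by blast
        ultimately show "d (a n) h \<le> d (b n) y + 5 * e"
          using \<nu>[of k] y(2)[of k] k commute[of "a (\<nu> k)" h] commute[of y "b (\<nu> k)"] by simp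
      qed simp
    qed
    moreover have "y \<in> H'"
    proof (rule dist_to_zero_imp_mem[OF SubgD(2,3)[OF H'] y(1)])
      show "dist_to H' y \<le> 0"
      proof (rule le_if_le_plus_eps[where c = 4])
        fix e :: real assume "e > 0"
        then obtain k where k: "1 / 2 ^ k < e" using small by blast
        have "dist_to H' y \<le> d y (b (\<nu> k))" using dist_to_le b by blast
        then show "dist_to H' y \<le> 0 + 4 * e" using y(2)[of k] k commute[of y "b (\<nu> k)"] by simp
      qed simp
    qed
    ultimately show ?thesis by blast
  qed
  then obtain \<psi> where \<psi>: "\<And>h. h \<in> H \<Longrightarrow> \<psi> h \<in> H'" "\<And>h n. h \<in> H \<Longrightarrow> d (b n) (\<psi> h) = d (a n) h"
    by metis
  have \<psi>D: "\<psi> h \<in> carrier D" if "h \<in> H" for h using \<psi>(1) inD that by blast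
  have iso\<psi>: "d (\<psi> h) (\<psi> h') = d h h'" if h: "h \<in> H" "h' \<in> H" for h h'
  proof -
    have 1: "d (\<psi> h) (\<psi> h') \<le> d h h' + 2 * e \<and> d h h' \<le> d (\<psi> h) (\<psi> h') + 2 * e" if "e > 0" for e
    proof -
      obtain n where n: "d h (a n) < e" using dense h \<open>e > 0\<close> by blast
      have "d (\<psi> h) (\<psi> h') \<le> d (b n) (\<psi> h) + d (b n) (\<psi> h')"
        using triangle[of "\<psi> h" "b n" "\<psi> h'"] commute \<psi>D bD h by simp
      moreover have "d (b n) (\<psi> h') \<le> d (b n) (\<psi> h) + d (\<psi> h) (\<psi> h')"
        using triangle \<psi>D bD h by simp
      moreover have "d h h' \<le> d h (a n) + d (a n) h'" "d (a n) h' \<le> d h (a n) + d h h'"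
        using triangle[of h "a n" h'] triangle[of "a n" h h'] commute[of "a n" h] aD inD(1) h by auto
      moreover have "d (b n) (\<psi> h) = d h (a n)" "d (b n) (\<psi> h') = d (a n) h'"
        using \<psi>(2) h commute by simp_all
      ultimately show ?thesis using n by linarith
    qed
    show ?thesis
      by (rule antisym; rule le_if_le_plus_eps[where c = 2]) (use 1 in auto)
  qed
  have mult\<psi>: "\<psi> (h \<otimes>\<^bsub>D\<^esub> h') = \<psi> h \<otimes>\<^bsub>D\<^esub> \<psi> h'" if h: "h \<in> H" "h' \<in> H" for h h'
  proof -
    have hh: "h \<otimes>\<^bsub>D\<^esub> h' \<in> H" using SubgD(1)[OF H] h by (simp add: subgroup.m_closed)
    \<comment> \<open>Each of the approximations with index \<open>n\<close>, \<open>m\<close>,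
      \<open>l\<close> costs one error in \<open>H\<close> and one in \<open>H'\<close>, six in
      all.\<close>
    have "d (\<psi> (h \<otimes>\<^bsub>D\<^esub> h')) (\<psi> h \<otimes>\<^bsub>D\<^esub> \<psi> h') \<le> 0"
    proof (rule le_if_le_plus_eps[where c = 6])
      fix e :: real assume e: "e > 0"
      obtain n where n: "d h (a n) < e" using dense h e by blast
      obtain m where m: "d h' (a m) < e" using dense h e by blast
      obtain l where l: "d (h \<otimes>\<^bsub>D\<^esub> h') (a l) < e" using dense hh e by blast
      have "d (\<psi> (h \<otimes>\<^bsub>D\<^esub> h')) (\<psi> h \<otimes>\<^bsub>D\<^esub> \<psi> h') \<le> d (\<psi> (h \<otimes>\<^bsub>D\<^esub> h')) (b l) + d (b l) (\<psi> h \<otimes>\<^bsub>D\<^esub> \<psi> h')"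
        using triangle \<psi>D bD h hh by simp
      moreover have "d (b l) (\<psi> h \<otimes>\<^bsub>D\<^esub> \<psi> h') \<le> d (b n \<otimes>\<^bsub>D\<^esub> b m) (b l) + d (b n \<otimes>\<^bsub>D\<^esub> b m) (\<psi> h \<otimes>\<^bsub>D\<^esub> \<psi> h')"
        using triangle[of "b l" "b n \<otimes>\<^bsub>D\<^esub> b m" "\<psi> h \<otimes>\<^bsub>D\<^esub> \<psi> h'"] commute \<psi>D bD h by simp
      moreover have "d (b n \<otimes>\<^bsub>D\<^esub> b m) (\<psi> h \<otimes>\<^bsub>D\<^esub> \<psi> h') \<le> d (b n) (\<psi> h) + d (b m) (\<psi> h')"
        using d_mult_le \<psi>D bD h by simp
      moreover have "d (a n \<otimes>\<^bsub>D\<^esub> a m) (a l) \<le> d (a n \<otimes>\<^bsub>D\<^esub> a m) (h \<otimes>\<^bsub>D\<^esub> h') + d (h \<otimes>\<^bsub>D\<^esub> h') (a l)"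
        using triangle aD inD(1) h by simp
      moreover have "d (a n \<otimes>\<^bsub>D\<^esub> a m) (h \<otimes>\<^bsub>D\<^esub> h') \<le> d (a n) h + d (a m) h'"
        using d_mult_le aD inD(1) h by simp
      moreover have "d (\<psi> (h \<otimes>\<^bsub>D\<^esub> h')) (b l) = d (h \<otimes>\<^bsub>D\<^esub> h') (a l)"
        "d (b n) (\<psi> h) = d (a n) h" "d (b m) (\<psi> h') = d (a m) h'" "d h (a n) = d (a n) h" "d h' (a m) = d (a m) h'"
        using \<psi>(2)[OF h(1), of n] \<psi>(2)[OF h(2), of m] \<psi>(2)[OF hh, of l] commute by metis+
      ultimately show "d (\<psi> (h \<otimes>\<^bsub>D\<^esub> h')) (\<psi> h \<otimes>\<^bsub>D\<^esub> \<psi> h') \<le> 0 + 6 * e"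
        using n m l mult[of n m l] e by linarith
    qed simp
    then have "d (\<psi> (h \<otimes>\<^bsub>D\<^esub> h')) (\<psi> h \<otimes>\<^bsub>D\<^esub> \<psi> h') = 0" using nonneg by (simp add: order_antisym)
    then show ?thesis using \<psi>D h hh by simp
  qed
  have "\<psi> \<in> hom (D\<lparr>carrier := H\<rparr>) (D\<lparr>carrier := H'\<rparr>)"
    using \<psi>(1) mult\<psi> by (intro homI) auto
  moreover have "inj_on \<psi> H"
  proof (rule inj_onI)
    fix h h' assume h: "h \<in> H" "h' \<in> H" "\<psi> h = \<psi> h'"
    then have "d h h' = 0" using iso\<psi>[of h h'] \<psi>D by simp
    then show "h = h'" using h inD by simp
  qed
  ultimately have "\<psi> \<in> isometric_group_embeddings (D\<lparr>carrier := H\<rparr>) d (D\<lparr>carrier := H'\<rparr>) d"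
    using iso\<psi> unfolding isometric_group_embeddings_def mon_def by auto
  then show ?thesis unfolding isometric_embeddability_def using H H' by blast
qed

context dense_polish_group
begin

definition approx :: "(nat \<Rightarrow> nat) \<Rightarrow> nat \<Rightarrow> nat \<Rightarrow> 'g" where
  "approx z i k = q (z (prod_encode (i, k)))"

text \<open>Row \<open>2n\<close> of \<open>z\<close> codes the \<open>n\<close>-th term of a dense sequence in \<open>H\<close>, and row \<open>2n + 1\<close> its
  image in \<open>H'\<close>. The first clause makes the sequences Cauchy, so no \<open>lim\<close> takes a junk value.\<close>

definition witness :: "'g set \<Rightarrow> 'g set \<Rightarrow> (nat \<Rightarrow> nat) \<Rightarrow> bool" where
  "witness H H' z \<longleftrightarrow>
     (\<forall>i k. d (approx z i k) (approx z i (Suc k)) \<le> 1 / 2 ^ k) \<and>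
     (\<forall>n k. dist_to H (approx z (2 * n) k) \<le> 1 / 2 ^ k) \<and>
     (\<forall>n k. dist_to H' (approx z (2 * n + 1) k) \<le> 1 / 2 ^ k) \<and>
     (\<forall>m j. dist_to H (q m) < 1 / real (Suc j) \<longrightarrow> (\<exists>n. lim (\<lambda>k. d (q m) (approx z (2 * n) k)) < 1 / real (Suc j))) \<and>
     (\<forall>n m. lim (\<lambda>k. d (approx z (2 * n + 1) k) (approx z (2 * m + 1) k)) = lim (\<lambda>k. d (approx z (2 * n) k) (approx z (2 * m) k))) \<and>
     (\<forall>n m l. lim (\<lambda>k. d (approx z (2 * n + 1) k \<otimes>\<^bsub>D\<^esub> approx z (2 * m + 1) k) (approx z (2 * l + 1) k))
            = lim (\<lambda>k. d (approx z (2 * n) k \<otimes>\<^bsub>D\<^esub> approx z (2 * m) k) (approx z (2 * l) k)))"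

lemma approx_closed: "approx z i k \<in> carrier D"
  unfolding approx_def by (rule q_closed)

text \<open>Replaces the limits in \<open>witness\<close> by distances between the limit points
  \<open>A i\<close>; used in both directions of the equivalence.\<close>

lemma witness_limits:
  assumes A: "\<And>i. A i \<in> carrier D" "\<And>i. (\<lambda>k. d (approx z i k) (A i)) \<longlonglongrightarrow> 0"
  shows "x \<in> carrier D \<Longrightarrow> lim (\<lambda>k. d x (approx z i k)) = d x (A i)"
    and "lim (\<lambda>k. d (approx z i k) (approx z j k)) = d (A i) (A j)"
    and "lim (\<lambda>k. d (approx z i k \<otimes>\<^bsub>D\<^esub> approx z j k) (approx z l k)) = d (A i \<otimes>\<^bsub>D\<^esub> A j) (A l)"
proof -
  show "lim (\<lambda>k. d x (approx z i k)) = d x (A i)" if x: "x \<in> carrier D"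
    using tendsto_mdist[of "\<lambda>_. x" "approx z i" x "A i"] x A approx_closed by (intro limI) simp
  show "lim (\<lambda>k. d (approx z i k) (approx z j k)) = d (A i) (A j)"
    using A approx_closed by (intro limI tendsto_mdist) auto
  have "(\<lambda>k. d (approx z i k \<otimes>\<^bsub>D\<^esub> approx z j k) (A i \<otimes>\<^bsub>D\<^esub> A j)) \<longlonglongrightarrow> 0"
  proof (rule Lim_null_comparison)
    show "\<forall>\<^sub>F k in sequentially. norm (d (approx z i k \<otimes>\<^bsub>D\<^esub> approx z j k) (A i \<otimes>\<^bsub>D\<^esub> A j)) \<le> d (approx z i k) (A i) + d (approx z j k) (A j)"
      using d_mult_le A approx_closed by simp
    show "(\<lambda>k. d (approx z i k) (A i) + d (approx z j k) (A j)) \<longlonglongrightarrow> 0"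
      using tendsto_add[OF A(2)[of i] A(2)[of j]] by simp
  qed
  then show "lim (\<lambda>k. d (approx z i k \<otimes>\<^bsub>D\<^esub> approx z j k) (approx z l k)) = d (A i \<otimes>\<^bsub>D\<^esub> A j) (A l)"
    using A approx_closed by (intro limI tendsto_mdist) auto
qed

text \<open>Density in \<open>H\<close> is tested at the points \<open>q m\<close> near
  \<open>H\<close>, so that only countable quantifiers occur; an element \<open>h\<close> is reached
  through a \<open>q m\<close> close to it.\<close>

lemma witness_imp_embeddable:
  assumes H: "H \<in> Subg D d" and H': "H' \<in> Subg D d" and w: "witness H H' z"
  shows "(H, H') \<in> isometric_embeddability D d"
proof -
  have step: "\<And>i k. d (approx z i k) (approx z i (Suc k)) \<le> 1 / 2 ^ k"
    and inH: "\<And>n k. dist_to H (approx z (2 * n) k) \<le> 1 / 2 ^ k"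
    and inH': "\<And>n k. dist_to H' (approx z (2 * n + 1) k) \<le> 1 / 2 ^ k"
    and den: "\<And>m j. dist_to H (q m) < 1 / real (Suc j) \<Longrightarrow> \<exists>n. lim (\<lambda>k. d (q m) (approx z (2 * n) k)) < 1 / real (Suc j)"
    and iso: "\<And>n m. lim (\<lambda>k. d (approx z (2 * n + 1) k) (approx z (2 * m + 1) k)) = lim (\<lambda>k. d (approx z (2 * n) k) (approx z (2 * m) k))"
    and mult: "\<And>n m l. lim (\<lambda>k. d (approx z (2 * n + 1) k \<otimes>\<^bsub>D\<^esub> approx z (2 * m + 1) k) (approx z (2 * l + 1) k))
            = lim (\<lambda>k. d (approx z (2 * n) k \<otimes>\<^bsub>D\<^esub> approx z (2 * m) k) (approx z (2 * l) k))"
    using w unfolding witness_def by blast+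
  have "\<exists>x\<in>carrier D. \<forall>k. d (approx z i k) x \<le> 2 * 1 / 2 ^ k" for i
    using fast_Cauchy_limit[OF complete, of "approx z i" 1] approx_closed step by metis
  then obtain A where A: "\<And>i. A i \<in> carrier D" "\<And>i k. d (approx z i k) (A i) \<le> 2 * 1 / 2 ^ k" by metis
  have lim0: "(\<lambda>k. d (approx z i k) (A i)) \<longlonglongrightarrow> 0" for i
    by (rule Lim_null_comparison[OF _ inverse_pow2_tendsto[of 2]]) (use A(2) in simp)
  note lims = witness_limits[OF A(1) lim0]
  have mem: "A i \<in> G" if G: "G \<in> Subg D d" and le: "\<And>k. dist_to G (approx z i k) \<le> 1 / 2 ^ k" for G i
  proof (rule dist_to_zero_imp_mem[OF SubgD(2,3)[OF G] A(1)])
    have "dist_to G (A i) \<le> 3 / 2 ^ k" for k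
      using dist_to_lipschitz[OF SubgD(3,4)[OF G] A(1)[of i] approx_closed[of z i k]] A(2)[of i k] le[of k]
        commute[of "A i" "approx z i k"] by simp
    then show "dist_to G (A i) \<le> 0"
      by (intro LIMSEQ_le_const[OF inverse_pow2_tendsto[of 3]]) auto
  qed
  show ?thesis
  proof (rule embeddable_if_dense_sequences[OF H H'])
    show "A (2 * n) \<in> H" for n using mem[OF H inH] .
    show "A (2 * n + 1) \<in> H'" for n using mem[OF H' inH'] .
    show "d (A (2 * n + 1)) (A (2 * m + 1)) = d (A (2 * n)) (A (2 * m))" for n m
      using iso[of n m] unfolding lims .
    show "d (A (2 * n + 1) \<otimes>\<^bsub>D\<^esub> A (2 * m + 1)) (A (2 * l + 1)) = d (A (2 * n) \<otimes>\<^bsub>D\<^esub> A (2 * m)) (A (2 * l))" for n m l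
      using mult[of n m l] unfolding lims .
    fix h and e :: real assume h: "h \<in> H" and "e > 0"
    then obtain j where j: "inverse (real (Suc j)) < e / 2" using reals_Archimedean[of "e / 2"] by auto
    have hD: "h \<in> carrier D" using h SubgD(4)[OF H] by blast
    then obtain m where m: "d (q m) h < 1 / real (Suc j)" using q_dense[of h "1 / real (Suc j)"] by auto
    then have "dist_to H (q m) < 1 / real (Suc j)" using dist_to_le[OF h, of "q m"] by simp
    then obtain n where n: "d (q m) (A (2 * n)) < 1 / real (Suc j)" using den lims(1)[OF q_closed] by metis
    have "d h (A (2 * n)) \<le> d (q m) h + d (q m) (A (2 * n))"
      using triangle[of h "q m" "A (2 * n)"] commute hD q_closed A(1) by simp
    then show "\<exists>n. d h (A (2 * n)) < e"
      using m n j by (intro exI[of _ n]) (simp add: inverse_eq_divide)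
  qed
qed

lemma embeddable_imp_witness:
  assumes emb: "(H, H') \<in> isometric_embeddability D d"
  shows "\<exists>z. witness H H' z"
proof -
  have H: "H \<in> Subg D d" and H': "H' \<in> Subg D d" using emb unfolding isometric_embeddability_def by auto
  obtain \<psi> where "\<psi> \<in> isometric_group_embeddings (D\<lparr>carrier := H\<rparr>) d (D\<lparr>carrier := H'\<rparr>) d"
    using emb unfolding isometric_embeddability_def by blast
  then have \<psi>: "\<And>x. x \<in> H \<Longrightarrow> \<psi> x \<in> H'" "\<And>x y. x \<in> H \<Longrightarrow> y \<in> H \<Longrightarrow> d (\<psi> x) (\<psi> y) = d x y"
    "\<And>x y. x \<in> H \<Longrightarrow> y \<in> H \<Longrightarrow> \<psi> (x \<otimes>\<^bsub>D\<^esub> y) = \<psi> x \<otimes>\<^bsub>D\<^esub> \<psi> y"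
    unfolding isometric_group_embeddings_def mon_def hom_def by auto
  \<comment> \<open>One point of \<open>H\<close> is selected from each ball of radius 1/(j + 1)
    about \<open>q m\<close> that meets \<open>H\<close>; the identity is the default for the
    others.\<close>
  define a where "a n = (case prod_decode n of (m, j) \<Rightarrow>
    if \<exists>h\<in>H. d (q m) h < 1 / real (Suc j) then SOME h. h \<in> H \<and> d (q m) h < 1 / real (Suc j) else \<one>\<^bsub>D\<^esub>)" for n
  have a_near: "a (prod_encode (m, j)) \<in> H \<and> d (q m) (a (prod_encode (m, j))) < 1 / real (Suc j)"
    if "\<exists>h\<in>H. d (q m) h < 1 / real (Suc j)" for m j
  proof -
    have "\<exists>h. h \<in> H \<and> d (q m) h < 1 / real (Suc j)" using that by blast
    from someI_ex[OF this] show ?thesis unfolding a_def using that by (simp del: of_nat_Suc)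
  qed
  have a: "a n \<in> H" for n
  proof (cases "prod_decode n")
    case (Pair m j)
    then have n: "n = prod_encode (m, j)" by (metis prod_decode_inverse)
    show ?thesis
    proof (cases "\<exists>h\<in>H. d (q m) h < 1 / real (Suc j)")
      case True
      then show ?thesis using a_near n by blast
    next
      case False
      then show ?thesis unfolding n a_def using SubgD(5)[OF H] by (simp del: of_nat_Suc)
    qed
  qed
  define A where "A i = (if even i then a (i div 2) else \<psi> (a (i div 2)))" for i
  have A: "A (2 * n) = a n" "A (2 * n + 1) = \<psi> (a n)" for n unfolding A_def by auto
  have AD: "A i \<in> carrier D" for i
    unfolding A_def using a \<psi>(1) SubgD(4)[OF H] SubgD(4)[OF H'] by auto
  \<comment> \<open>The factor 1/4 leaves room for the Cauchy clause: 1/4 + 1/8 is below 1.\<close>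
  have "\<exists>m. d (q m) (A i) < 1 / 4 / 2 ^ k" for i k using q_dense[OF AD] by simp
  then obtain c where c: "\<And>i k. d (q (c i k)) (A i) < 1 / 4 / 2 ^ k" by metis
  define z where "z j = (case prod_decode j of (i, k) \<Rightarrow> c i k)" for j
  have P: "d (approx z i k) (A i) < 1 / 4 / 2 ^ k" for i k
    unfolding approx_def z_def using c by simp
  have lim0: "(\<lambda>k. d (approx z i k) (A i)) \<longlonglongrightarrow> 0" for i
    by (rule Lim_null_comparison[OF _ inverse_pow2_tendsto[of "1 / 4"]]) (use less_imp_le[OF P] in simp)
  note lims = witness_limits[OF AD lim0]
  have le: "d (approx z i k) (A i) \<le> 1 / 2 ^ k" for i k
    using P[of i k] by (rule less_imp_le[OF less_le_trans]) (simp add: field_simps)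
  have "witness H H' z"
    unfolding witness_def lims lims(1)[OF q_closed]
  proof (intro conjI allI impI)
    show "d (approx z i k) (approx z i (Suc k)) \<le> 1 / 2 ^ k" for i k
    proof -
      have "d (approx z i k) (approx z i (Suc k)) \<le> d (approx z i k) (A i) + d (approx z i (Suc k)) (A i)"
        using triangle[of "approx z i k" "A i" "approx z i (Suc k)"] commute[of "A i"] approx_closed AD by simp
      also have "\<dots> \<le> 1 / 4 / 2 ^ k + 1 / 4 / 2 ^ Suc k"
        using P[of i k] P[of i "Suc k"] by simp
      also have "\<dots> \<le> 1 / 2 ^ k" by (simp add: field_simps)
      finally show ?thesis .
    qed
    show "dist_to H (approx z (2 * n) k) \<le> 1 / 2 ^ k" for n k
      using dist_to_le[OF a[of n], of "approx z (2 * n) k"] le[of "2 * n" k] unfolding A by simp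
    show "dist_to H' (approx z (2 * n + 1) k) \<le> 1 / 2 ^ k" for n k
      using dist_to_le[OF \<psi>(1)[OF a[of n]], of "approx z (2 * n + 1) k"] le[of "2 * n + 1" k] unfolding A by simp
    show "\<exists>n. d (q m) (A (2 * n)) < 1 / real (Suc j)" if "dist_to H (q m) < 1 / real (Suc j)" for m j
      using that a_near[of m j] dist_to_less_iff[OF SubgD(3)[OF H]] unfolding A by blast
    show "d (A (2 * n + 1)) (A (2 * m + 1)) = d (A (2 * n)) (A (2 * m))" for n m
      unfolding A using \<psi>(2) a by simp
    show "d (A (2 * n + 1) \<otimes>\<^bsub>D\<^esub> A (2 * m + 1)) (A (2 * l + 1)) = d (A (2 * n) \<otimes>\<^bsub>D\<^esub> A (2 * m)) (A (2 * l))" for n m l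
      unfolding A using \<psi>(2)[of "a n \<otimes>\<^bsub>D\<^esub> a m" "a l"] \<psi>(3)[of "a n" "a m"] a SubgD(1)[OF H]
      by (simp add: subgroup.m_closed)
  qed
  then show ?thesis by blast
qed

lemma analytic_embeddability:
  "analytic_subset (Subg_space D d \<Otimes>\<^sub>M Subg_space D d) (isometric_embeddability D d)"
proof -
  let ?S = "(Subg_space D d \<Otimes>\<^sub>M Subg_space D d) \<Otimes>\<^sub>M (borel :: (nat \<Rightarrow> nat) measure)"
  define B where "B = {w \<in> space ?S. witness (fst (fst w)) (snd (fst w)) (snd w)}"
  have [measurable]: "(\<lambda>w. snd w i) \<in> measurable ?S (count_space UNIV)" for i
    by (rule measurable_compose[OF measurable_snd coordinate_measurable])
  have ds1: "(\<lambda>w. dist_to (fst (fst w)) (q m)) \<in> borel_measurable ?S"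
    and ds2: "(\<lambda>w. dist_to (snd (fst w)) (q m)) \<in> borel_measurable ?S" for m
    by (rule measurable_compose[OF _ dist_to_measurable[OF q_closed]], measurable)+
  note [measurable] = ds1 ds2
  \<comment> \<open>The centre depends on the sequence through an index with countably many values,
    so measurability is checked index by index.\<close>
  have [measurable]: "(\<lambda>w. dist_to (fst (fst w)) (q (snd w i))) \<in> borel_measurable ?S"
    "(\<lambda>w. dist_to (snd (fst w)) (q (snd w i))) \<in> borel_measurable ?S" for i
    by (rule measurable_compose_countable[where f = "\<lambda>m w. dist_to (fst (fst w)) (q m)"]
        measurable_compose_countable[where f = "\<lambda>m w. dist_to (snd (fst w)) (q m)"]; measurable)+
  have [measurable]: "(\<lambda>w. d (q (snd w i)) (q (snd w j))) \<in> borel_measurable ?S" for i j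
    by measurable
  have [measurable]: "(\<lambda>w. d (q m) (q (snd w j))) \<in> borel_measurable ?S" for m j
    by measurable
  have [measurable]: "(\<lambda>w. d (q (snd w i) \<otimes>\<^bsub>D\<^esub> q (snd w j)) (q (snd w l))) \<in> borel_measurable ?S" for i j l
    by measurable
  have "B \<in> sets ?S"
    unfolding B_def witness_def approx_def by measurable
  moreover have "isometric_embeddability D d = fst ` B"
  proof
    show "isometric_embeddability D d \<subseteq> fst ` B"
    proof (clarify)
      fix H H' assume HH: "(H, H') \<in> isometric_embeddability D d"
      then obtain z where "witness H H' z" using embeddable_imp_witness by blast
      moreover have "H \<in> Subg D d" "H' \<in> Subg D d" using HH unfolding isometric_embeddability_def by auto
      ultimately have "((H, H'), z) \<in> B"
        unfolding B_def by (simp add: space_pair_measure space_Subg_space)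
      then show "(H, H') \<in> fst ` B" by force
    qed
    show "fst ` B \<subseteq> isometric_embeddability D d"
      unfolding B_def using witness_imp_embeddable by (auto simp: space_pair_measure space_Subg_space)
  qed
  ultimately show ?thesis unfolding analytic_subset_def by blast
qed

lemma preorder_embeddability: "preorder_on (Subg D d) (isometric_embeddability D d)"
  unfolding preorder_on_def
proof (intro conjI)
  show "isometric_embeddability D d \<subseteq> Subg D d \<times> Subg D d"
    unfolding isometric_embeddability_def by blast
  show "refl_on (Subg D d) (isometric_embeddability D d)"
  proof (rule refl_onI)
    fix H assume "H \<in> Subg D d"
    moreover have "id \<in> isometric_group_embeddings (D\<lparr>carrier := H\<rparr>) d (D\<lparr>carrier := H\<rparr>) d"
      unfolding isometric_group_embeddings_def mon_def hom_def by auto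
    ultimately show "(H, H) \<in> isometric_embeddability D d"
      unfolding isometric_embeddability_def by blast
  qed
  show "trans (isometric_embeddability D d)"
  proof (rule transI)
    fix F G H assume FG: "(F, G) \<in> isometric_embeddability D d" and GH: "(G, H) \<in> isometric_embeddability D d"
    obtain \<phi> where \<phi>: "\<phi> \<in> isometric_group_embeddings (D\<lparr>carrier := F\<rparr>) d (D\<lparr>carrier := G\<rparr>) d"
      using FG unfolding isometric_embeddability_def by blast
    obtain \<psi> where \<psi>: "\<psi> \<in> isometric_group_embeddings (D\<lparr>carrier := G\<rparr>) d (D\<lparr>carrier := H\<rparr>) d"
      using GH unfolding isometric_embeddability_def by blast
    have "\<psi> \<circ> \<phi> \<in> isometric_group_embeddings (D\<lparr>carrier := F\<rparr>) d (D\<lparr>carrier := H\<rparr>) d"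
      using \<phi> \<psi> mon_compose[of \<phi> "D\<lparr>carrier := F\<rparr>" "D\<lparr>carrier := G\<rparr>" \<psi> "D\<lparr>carrier := H\<rparr>"]
      unfolding isometric_group_embeddings_def by (auto simp: mon_def hom_def Pi_iff)
    then show "(F, H) \<in> isometric_embeddability D d"
      using FG GH unfolding isometric_embeddability_def by blast
  qed
qed

end

theorem (in polish_group) Sigma11_embeddability:
  "Sigma11_quasi_order (Subg_space D d) (isometric_embeddability D d)"
proof -
  obtain q :: "nat \<Rightarrow> 'g" where q: "range q \<subseteq> carrier D" "\<And>y e. y \<in> carrier D \<Longrightarrow> e > 0 \<Longrightarrow> \<exists>n. d (q n) y < e"
    using separable_dense_sequence[OF separable] one_closed by blast
  interpret dense_polish_group K D d q
    by unfold_locales (use q in auto)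
  show ?thesis
    unfolding Sigma11_quasi_order_def space_Subg_space
    using standard_borel_Subg preorder_embeddability analytic_embeddability by blast
qed

section \<open>Completeness\<close>

text \<open>A point is coded by the balls, with dense centres and radii 1/(j + 1), that contain it.
  The last two properties of the code let Borel sets pass to sequences and back; binary values
  provide the compactness used for paths.\<close>

lemma standard_borel_code:
  assumes "standard_borel_space X" "space X \<noteq> {}"
  obtains f :: "'x \<Rightarrow> nat \<Rightarrow> nat"
  where "\<And>i. (\<lambda>x. f x i) \<in> measurable X (count_space UNIV)" "\<And>x i. f x i \<le> 1"
    "inj_on f (space X)" "f ` space X \<in> sets borel"
    "\<And>A. A \<in> sets X \<Longrightarrow> \<exists>B\<in>sets borel. A = f -` B \<inter> space X"
proof -
  obtain T where T: "polish_topology T" "topspace T = space X"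
    "sets X = sigma_sets (topspace T) {U. openin T U}"
    using assms(1) unfolding standard_borel_space_def by blast
  then obtain M d where M: "Metric_space M d" and cpl: "Metric_space.mcomplete M d" and Td: "T = Metric_space.mtopology M d"
    unfolding polish_topology_def completely_metrizable_space_def by blast
  interpret Metric_space M d by (rule M)
  have MX: "M = space X" using T(2) unfolding Td by simp
  obtain q :: "nat \<Rightarrow> 'x" where q: "range q \<subseteq> M" and dense: "\<And>y e. y \<in> M \<Longrightarrow> e > 0 \<Longrightarrow> \<exists>n. d (q n) y < e"
    using separable_dense_sequence T(1) assms(2) unfolding polish_topology_def Td MX by blast
  have qM: "q n \<in> M" for n using q by blast
  define \<rho> where "\<rho> j = 1 / real (Suc j)" for j
  have \<rho>: "\<rho> j > 0" for j unfolding \<rho>_def by simp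
  have small: "\<exists>j. \<rho> j < e" if "e > 0" for e
    using reals_Archimedean[OF that] unfolding \<rho>_def by (simp add: inverse_eq_divide)
  define f where "f x i = (case prod_decode i of (n, j) \<Rightarrow> if d (q n) x < \<rho> j then 1 else (0 :: nat))" for x i
  have f: "f x (prod_encode (n, j)) = 1 \<longleftrightarrow> d (q n) x < \<rho> j" for x n j unfolding f_def by simp
  have f_le: "f x i \<le> 1" for x i unfolding f_def by (simp split: prod.splits)
  have ball: "mball (q n) (\<rho> j) = {x \<in> space X. f x (prod_encode (n, j)) = 1}" for n j
    using qM unfolding f by (auto simp: MX[symmetric])
  have "mball x r \<in> sets X" for x r
    unfolding T(3) Td by (rule sigma_sets.Basic) simp
  then have bit: "{x \<in> space X. f x i = 1} \<in> sets X" for i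
    using ball[of "fst (prod_decode i)" "snd (prod_decode i)"] by (simp add: prod_decode_inverse) metis
  have meas: "(\<lambda>x. f x i) \<in> measurable X (count_space UNIV)" for i
  proof -
    have "(\<lambda>x. f x i) = (\<lambda>x. if f x i = 1 then 1 else 0)" 
      using f_le le_Suc_eq by (fastforce simp: fun_eq_iff)
    moreover have "(\<lambda>x. if f x i = 1 then 1 else 0) \<in> measurable X (count_space UNIV)"
      by (rule measurable_If) (use bit in auto)
    ultimately show ?thesis by (simp only:)
  qed
  have inj: "inj_on f (space X)"
  proof (rule inj_onI)
    fix x y assume xy: "x \<in> space X" "y \<in> space X" "f x = f y"
    have "d x y \<le> 0"
    proof (rule le_if_le_plus_eps[where c = 2])
      fix e :: real assume "e > 0"
      then obtain j where j: "\<rho> j < e" using small by blast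
      obtain n where n: "d (q n) x < \<rho> j" using dense[of x "\<rho> j"] \<rho> xy MX by blast
      then have "d (q n) y < \<rho> j" using f xy(3) by metis
      moreover have "d x y \<le> d (q n) x + d (q n) y" using triangle[of x "q n" y] commute xy MX qM by simp
      ultimately show "d x y \<le> 0 + 2 * e" using n j by simp
    qed simp
    then show "x = y" using xy MX nonneg by (metis order_antisym zero)
  qed
  \<comment> \<open>The codes of points: sets of balls that form a round filter containing arbitrarily small balls.\<close>
  define C where "C = {w :: nat \<Rightarrow> nat. (\<forall>i. w i \<le> 1) \<and> (\<forall>j. \<exists>n. w (prod_encode (n, j)) = 1) \<and>
    (\<forall>n j m i. w (prod_encode (n, j)) = 1 \<longrightarrow> w (prod_encode (m, i)) = 1 \<longrightarrow> d (q n) (q m) < \<rho> j + \<rho> i) \<and>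
    (\<forall>n j. w (prod_encode (n, j)) = 1 \<longleftrightarrow> (\<exists>m i. w (prod_encode (m, i)) = 1 \<and> d (q n) (q m) + \<rho> i < \<rho> j))}"
  have "C \<in> sets borel"
  proof -
    note coordinate_measurable[measurable]
    have "C = {w \<in> space borel. (\<forall>i. w i \<le> 1) \<and> (\<forall>j. \<exists>n. w (prod_encode (n, j)) = 1) \<and>
    (\<forall>n j m i. w (prod_encode (n, j)) = 1 \<longrightarrow> w (prod_encode (m, i)) = 1 \<longrightarrow> d (q n) (q m) < \<rho> j + \<rho> i) \<and>
    (\<forall>n j. w (prod_encode (n, j)) = 1 \<longleftrightarrow> (\<exists>m i. w (prod_encode (m, i)) = 1 \<and> d (q n) (q m) + \<rho> i < \<rho> j))}"
      unfolding C_def by simp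
    also have "\<dots> \<in> sets borel" by measurable
    finally show ?thesis .
  qed
  moreover have "f ` space X = C"
  proof
    show "f ` space X \<subseteq> C"
    proof (rule image_subsetI)
      fix x assume "x \<in> space X"
      then have x: "x \<in> M" using MX by simp
      have 1: "\<exists>n. d (q n) x < \<rho> j" for j using dense[OF x \<rho>] .
      have 2: "d (q n) (q m) < \<rho> j + \<rho> i" if "d (q n) x < \<rho> j" "d (q m) x < \<rho> i" for n m i j
        using triangle[of "q n" x "q m"] commute[of x] x qM that by fastforce
      have 3: "d (q n) x < \<rho> j \<longleftrightarrow> (\<exists>m i. d (q m) x < \<rho> i \<and> d (q n) (q m) + \<rho> i < \<rho> j)" for n j
      proof
        assume *: "d (q n) x < \<rho> j"
        \<comment> \<open>Half of the gap, since \<open>\<rho> i\<close> is spent twice: for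
          reaching \<open>q m\<close> and as the radius of the smaller ball.\<close>
        obtain i where i: "\<rho> i < (\<rho> j - d (q n) x) / 2" using small[of "(\<rho> j - d (q n) x) / 2"] * by auto
        obtain m where m: "d (q m) x < \<rho> i" using dense[OF x \<rho>] by blast
        have "d (q n) (q m) \<le> d (q n) x + d (q m) x" using triangle[of "q n" x "q m"] commute[of x] x qM by simp
        then show "\<exists>m i. d (q m) x < \<rho> i \<and> d (q n) (q m) + \<rho> i < \<rho> j"
          using i m by (intro exI[of _ m] exI[of _ i]) auto
      next
        assume "\<exists>m i. d (q m) x < \<rho> i \<and> d (q n) (q m) + \<rho> i < \<rho> j"
        then show "d (q n) x < \<rho> j" using triangle[OF qM qM x] by (meson add_left_mono less_imp_le order_le_less_trans)
      qed
      show "f x \<in> C"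
        unfolding C_def mem_Collect_eq f
        by (intro conjI allI impI) (rule f_le, rule 1, erule (1) 2, rule 3)
    qed
    show "C \<subseteq> f ` space X"
    proof
      fix w assume "w \<in> C"
      then have w_le: "\<And>i. w i \<le> 1" and w1: "\<And>j. \<exists>n. w (prod_encode (n, j)) = 1"
        and w2: "\<And>n j m i. w (prod_encode (n, j)) = 1 \<Longrightarrow> w (prod_encode (m, i)) = 1 \<Longrightarrow> d (q n) (q m) < \<rho> j + \<rho> i"
        and w3: "\<And>n j. w (prod_encode (n, j)) = 1 \<longleftrightarrow> (\<exists>m i. w (prod_encode (m, i)) = 1 \<and> d (q n) (q m) + \<rho> i < \<rho> j)"
        unfolding C_def by blast+
      obtain \<nu> where \<nu>: "\<And>j. w (prod_encode (\<nu> j, j)) = 1" using w1 by metis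
      have "MCauchy (\<lambda>j. q (\<nu> j))"
        unfolding MCauchy_def
      proof (intro conjI allI impI)
        show "range (\<lambda>j. q (\<nu> j)) \<subseteq> M" using qM by blast
        fix e :: real assume "e > 0"
        then obtain N where N: "\<rho> N < e / 2" using small[of "e / 2"] by auto
        have mono: "\<rho> n \<le> \<rho> N" if "N \<le> n" for n unfolding \<rho>_def using that by (simp add: frac_le)
        have "d (q (\<nu> n)) (q (\<nu> n')) < e" if "N \<le> n" "N \<le> n'" for n n'
          using w2[OF \<nu>[of n] \<nu>[of n']] mono[OF that(1)] mono[OF that(2)] N by simp
        then show "\<exists>N. \<forall>n n'. N \<le> n \<longrightarrow> N \<le> n' \<longrightarrow> d (q (\<nu> n)) (q (\<nu> n')) < e" by blast
      qed
      then obtain x where "limitin mtopology (\<lambda>j. q (\<nu> j)) x sequentially" using cpl unfolding mcomplete_def by blast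
      then have x: "x \<in> M" and lim: "(\<lambda>j. d (q (\<nu> j)) x) \<longlonglongrightarrow> 0" unfolding limitin_metric_dist_null by auto
      have \<rho>0: "\<rho> \<longlonglongrightarrow> 0"
        unfolding \<rho>_def using LIMSEQ_inverse_real_of_nat by (simp add: inverse_eq_divide)
      \<comment> \<open>Only a weak inequality survives the limit; the roundness condition
        \<open>w3\<close> restores strictness in \<open>iff\<close>.\<close>
      have le: "d (q n) x \<le> \<rho> j" if "w (prod_encode (n, j)) = 1" for n j
      proof (rule LIMSEQ_le_const)
        show "(\<lambda>i. \<rho> j + \<rho> i + d (q (\<nu> i)) x) \<longlonglongrightarrow> \<rho> j"
          using tendsto_add[OF tendsto_add[OF tendsto_const[of "\<rho> j"] \<rho>0] lim] by simp
        have "d (q n) x \<le> \<rho> j + \<rho> i + d (q (\<nu> i)) x" for i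
          using triangle[OF qM qM x, of n "\<nu> i"] w2[OF that \<nu>[of i]] by simp
        then show "\<exists>N. \<forall>i\<ge>N. d (q n) x \<le> \<rho> j + \<rho> i + d (q (\<nu> i)) x" by blast
      qed
      have iff: "w (prod_encode (n, j)) = 1 \<longleftrightarrow> d (q n) x < \<rho> j" for n j
      proof
        assume "w (prod_encode (n, j)) = 1"
        then obtain m i where mi: "w (prod_encode (m, i)) = 1" "d (q n) (q m) + \<rho> i < \<rho> j" using w3 by blast
        then show "d (q n) x < \<rho> j" using triangle[OF qM qM x, of n m] le[OF mi(1)] by simp
      next
        assume *: "d (q n) x < \<rho> j"
        obtain i where i: "\<rho> i < (\<rho> j - d (q n) x) / 2" using small[of "(\<rho> j - d (q n) x) / 2"] * by auto
        have "d (q n) (q (\<nu> i)) \<le> d (q n) x + d (q (\<nu> i)) x"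
          using triangle[of "q n" x "q (\<nu> i)"] commute[of x] x qM by simp
        then have "d (q n) (q (\<nu> i)) + \<rho> i < \<rho> j" using le[OF \<nu>[of i]] i by simp
        then show "w (prod_encode (n, j)) = 1" using w3 \<nu> by blast
      qed
      have "w i = f x i" for i
      proof -
        obtain n j where i: "i = prod_encode (n, j)" by (metis prod_decode_inverse surj_pair)
        have "w i = 1 \<longleftrightarrow> f x i = 1" unfolding i iff f ..
        then show ?thesis using w_le[of i] f_le[of x i] by linarith
      qed
      then have "w = f x" by (simp add: fun_eq_iff)
      then show "w \<in> f ` space X" using x MX by blast
    qed
  qed
  moreover have "\<exists>B\<in>sets borel. A = f -` B \<inter> space X" if "A \<in> sets X" for A
  proof -
    let ?V = "vimage_algebra (space X) f borel"
    have b: "mball (q n) (\<rho> j) \<in> sets ?V" for n j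
    proof -
      have "{w :: nat \<Rightarrow> nat. w (prod_encode (n, j)) = 1} \<in> sets borel"
        using measurable_sets[OF coordinate_measurable, of "{1}" "prod_encode (n, j)"] by (simp add: vimage_def)
      from in_vimage_algebra[OF this, of f "space X"] show ?thesis
        unfolding ball by (simp add: vimage_def Int_def conj_commute)
    qed
    have "{U. openin T U} \<subseteq> sets ?V"
    proof
      fix U assume "U \<in> {U. openin T U}"
      then have U: "U \<subseteq> M" "\<And>x. x \<in> U \<Longrightarrow> \<exists>r>0. mball x r \<subseteq> U" unfolding Td openin_mtopology by auto
      have "U = (\<Union>(n, j)\<in>{(n, j). mball (q n) (\<rho> j) \<subseteq> U}. mball (q n) (\<rho> j))"
      proof
        show "U \<subseteq> (\<Union>(n, j)\<in>{(n, j). mball (q n) (\<rho> j) \<subseteq> U}. mball (q n) (\<rho> j))"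
        proof
          fix x assume x: "x \<in> U"
          then have xM: "x \<in> M" using U by blast
          obtain r where r: "r > 0" "mball x r \<subseteq> U" using U x by blast
          obtain j where j: "\<rho> j < r / 2" using small[of "r / 2"] r by auto
          obtain n where n: "d (q n) x < \<rho> j" using dense[OF xM \<rho>] by blast
          have "mball (q n) (\<rho> j) \<subseteq> mball x r"
          proof
            fix y assume y: "y \<in> mball (q n) (\<rho> j)"
            then have "d x y \<le> d (q n) x + d (q n) y" using triangle[of x "q n" y] commute[of x] xM by simp
            then show "y \<in> mball x r" using y n j xM by simp
          qed
          moreover have "x \<in> mball (q n) (\<rho> j)" using n xM qM by simp
          ultimately show "x \<in> (\<Union>(n, j)\<in>{(n, j). mball (q n) (\<rho> j) \<subseteq> U}. mball (q n) (\<rho> j))" using r by blast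
        qed
      qed blast
      also have "\<dots> \<in> sets ?V"
        by (rule sets.countable_UN'') (use b in \<open>auto intro: countable_subset[OF subset_UNIV]\<close>)
      finally show "U \<in> sets ?V" .
    qed
    then have "sets X \<subseteq> sets ?V"
      unfolding T(3) T(2) using sets.sigma_sets_subset[of _ ?V] by simp
    then have "A \<in> sets ?V" using that by blast
    then show ?thesis by (subst (asm) sets_vimage_algebra2) auto
  qed
  ultimately show thesis using that meas f_le inj by blast
qed

section \<open>Trees for analytic quasi-orders\<close>

definition interleave3 :: "(nat \<Rightarrow> nat) \<Rightarrow> (nat \<Rightarrow> nat) \<Rightarrow> (nat \<Rightarrow> nat) \<Rightarrow> nat \<Rightarrow> nat" where
  "interleave3 a b z i = (if i mod 3 = 0 then a (i div 3) else if i mod 3 = 1 then b (i div 3) else z (i div 3))"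

lemma interleave3_nth [simp]: "interleave3 a b z (3 * i) = a i" "interleave3 a b z (Suc (3 * i)) = b i" "interleave3 a b z (Suc (Suc (3 * i))) = z i"
proof -
  have "Suc (3 * i) mod 3 = 1" "Suc (3 * i) div 3 = i" "Suc (Suc (3 * i)) mod 3 = 2" "Suc (Suc (3 * i)) div 3 = i"
    by presburger+
  then show "interleave3 a b z (3 * i) = a i" "interleave3 a b z (Suc (3 * i)) = b i" "interleave3 a b z (Suc (Suc (3 * i))) = z i"
    unfolding interleave3_def by simp_all
qed

lemma reindex_measurable: "(\<lambda>(w :: nat \<Rightarrow> nat) i. w (h i)) \<in> borel_measurable borel" for h :: "nat \<Rightarrow> nat"
  by (intro measurable_coordinatewise_then_product borel_measurable_continuous_onI continuous_on_product_coordinates)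

text \<open>The Borel set behind \<open>R\<close> is carried to sequences that code both points and
  the witness together; there it is a projection of a closed set, whose initial segments form
  \<open>T0\<close>. Injectivity of \<open>f\<close> passes transitivity of \<open>R\<close> to the
  codes.\<close>

lemma Sigma11_quasi_order_code:
  assumes R: "Sigma11_quasi_order X R" and ne: "space X \<noteq> {}"
  obtains f :: "'x \<Rightarrow> nat \<Rightarrow> nat" and T0
  where "\<And>i. (\<lambda>x. f x i) \<in> measurable X (count_space UNIV)" "inj_on f (space X)"
    "tree_relation (\<lambda>a b. \<exists>x y. (x, y) \<in> R \<and> a = f x \<and> b = f y) T0"
proof -
  have RX: "R \<subseteq> space X \<times> space X" and trans: "trans R"
    using R unfolding Sigma11_quasi_order_def preorder_on_def by auto
  obtain B where B: "B \<in> sets ((X \<Otimes>\<^sub>M X) \<Otimes>\<^sub>M (borel :: (nat \<Rightarrow> nat) measure))" "R = fst ` B"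
    using R unfolding Sigma11_quasi_order_def analytic_subset_def by blast
  obtain f :: "'x \<Rightarrow> nat \<Rightarrow> nat" where meas: "\<And>i. (\<lambda>x. f x i) \<in> measurable X (count_space UNIV)"
    and f_le: "\<And>x i. f x i \<le> 1" and inj: "inj_on f (space X)" and im: "f ` space X \<in> sets borel"
    and gen: "\<And>A. A \<in> sets X \<Longrightarrow> \<exists>B\<in>sets borel. A = f -` B \<inter> space X"
    using standard_borel_code[of X] R ne unfolding Sigma11_quasi_order_def by blast
  define \<Omega> where "\<Omega> = (space X \<times> space X) \<times> (UNIV :: (nat \<Rightarrow> nat) set)"
  define g where "g w = interleave3 (f (fst (fst w))) (f (snd (fst w))) (snd w)" for w
  \<comment> \<open>The sigma-algebra pulled back along \<open>g\<close> makes all three projections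
    measurable and hence contains \<open>B\<close>.\<close>
  let ?V = "vimage_algebra \<Omega> g borel"
  have g: "g \<in> measurable ?V borel" by (rule measurable_vimage_algebra1) simp
  have gpart: "(\<lambda>w i. g w (h i)) \<in> borel_measurable ?V" for h :: "nat \<Rightarrow> nat"
    using measurable_compose[OF g reindex_measurable[of h]] .
  have part: "p \<in> measurable ?V X" if p: "\<And>w. w \<in> \<Omega> \<Longrightarrow> p w \<in> space X" and eq: "\<And>w. f (p w) = (\<lambda>i. g w (h i))" for p h
  proof (rule measurableI)
    show "p w \<in> space X" if "w \<in> space ?V" for w using that p by simp
    fix A assume "A \<in> sets X"
    then obtain C where C: "C \<in> sets borel" "A = f -` C \<inter> space X" using gen by blast
    have "p -` A \<inter> space ?V = (\<lambda>w i. g w (h i)) -` C \<inter> space ?V"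
      using p unfolding C(2) by (auto simp: eq)
    then show "p -` A \<inter> space ?V \<in> sets ?V" using measurable_sets[OF gpart C(1)] by simp
  qed
  have "(\<lambda>w. fst (fst w)) \<in> measurable ?V X"
    by (rule part[where h = "\<lambda>i. 3 * i"]) (auto simp: \<Omega>_def g_def)
  moreover have "(\<lambda>w. snd (fst w)) \<in> measurable ?V X"
    by (rule part[where h = "\<lambda>i. Suc (3 * i)"]) (auto simp: \<Omega>_def g_def)
  moreover have "snd \<in> borel_measurable ?V"
    using gpart[of "\<lambda>i. Suc (Suc (3 * i))"] by (simp add: g_def)
  ultimately have "(\<lambda>w. ((fst (fst w), snd (fst w)), snd w)) \<in> measurable ?V ((X \<Otimes>\<^sub>M X) \<Otimes>\<^sub>M borel)"
    by (intro measurable_Pair)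
  then have "(\<lambda>w. w) \<in> measurable ?V ((X \<Otimes>\<^sub>M X) \<Otimes>\<^sub>M borel)" by simp
  from measurable_sets[OF this B(1)] have "B \<inter> \<Omega> \<in> sets ?V" by (simp add: vimage_def)
  moreover have B\<Omega>: "B \<subseteq> \<Omega>"
    using sets.sets_into_space[OF B(1)] unfolding \<Omega>_def by (simp add: space_pair_measure)
  ultimately have "B \<in> sets ?V" by (simp add: Int_absorb2)
  then obtain C where C: "C \<in> sets borel" "B = g -` C \<inter> \<Omega>"
    by (subst (asm) sets_vimage_algebra2) auto
  \<comment> \<open>Sequences whose first two parts do not code points are discarded, which keeps
    the set Borel because the range of \<open>f\<close> is.\<close>
  define C' where "C' = C \<inter> (\<lambda>w i. w (3 * i)) -` (f ` space X) \<inter> (\<lambda>w i. w (Suc (3 * i))) -` (f ` space X)"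
  have "(\<lambda>w i. w (h i)) -` (f ` space X) \<in> sets borel" for h :: "nat \<Rightarrow> nat"
    using measurable_sets[OF reindex_measurable im] by simp
  then have "C' \<in> sets borel" unfolding C'_def using C(1) by (intro sets.Int)
  then obtain Cl where Cl: "seq_closed Cl" "C' = fst ` Cl" using souslin_borel unfolding souslin_def by blast
  have in_C': "interleave3 a b z \<in> C' \<longleftrightarrow> (\<exists>x y. ((x, y), z) \<in> B \<and> a = f x \<and> b = f y)" for a b z
  proof
    assume m: "interleave3 a b z \<in> C'"
    then obtain x y where xy: "x \<in> space X" "y \<in> space X" "a = f x" "b = f y" unfolding C'_def by auto
    then have "((x, y), z) \<in> B" using m unfolding C(2) \<Omega>_def g_def C'_def by simp
    then show "\<exists>x y. ((x, y), z) \<in> B \<and> a = f x \<and> b = f y" using xy by blast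
  next
    assume "\<exists>x y. ((x, y), z) \<in> B \<and> a = f x \<and> b = f y"
    then show "interleave3 a b z \<in> C'" unfolding C(2) \<Omega>_def g_def C'_def by auto
  qed
  define Q where "Q a b \<longleftrightarrow> (\<exists>x y. (x, y) \<in> R \<and> a = f x \<and> b = f y)" for a b
  have Q: "Q a b \<longleftrightarrow> (\<exists>z. interleave3 a b z \<in> C')" for a b
    unfolding Q_def in_C' B(2) by force
  \<comment> \<open>The witness from \<open>B\<close> and the one from the closed set are merged
    into one sequence, on even and odd places.\<close>
  define inCl where "inCl a b y \<longleftrightarrow> (interleave3 a b (\<lambda>i. y (2 * i)), \<lambda>i. y (2 * i + 1)) \<in> Cl" for a b y
  define T0 where "T0 u v s \<longleftrightarrow> (\<exists>a b y n. inCl a b y \<and> u = pre a n \<and> v = pre b n \<and> s = pre y n)" for u v s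
  have "tree_relation Q T0"
  proof
    show "Q a b \<longleftrightarrow> (\<exists>z. \<forall>n. T0 (pre a n) (pre b n) (pre z n))" for a b
    proof
      assume "Q a b"
      then obtain z z' where zz: "(interleave3 a b z, z') \<in> Cl" unfolding Q Cl(2) by auto
      define y where "y i = (if even i then z (i div 2) else z' (i div 2))" for i
      have "inCl a b y" unfolding inCl_def y_def using zz by simp
      then show "\<exists>z. \<forall>n. T0 (pre a n) (pre b n) (pre z n)" unfolding T0_def by blast
    next
      assume "\<exists>z. \<forall>n. T0 (pre a n) (pre b n) (pre z n)"
      then obtain z where z: "\<And>n. T0 (pre a n) (pre b n) (pre z n)" by blast
      have "(interleave3 a b (\<lambda>i. z (2 * i)), \<lambda>i. z (2 * i + 1)) \<in> Cl"
      proof (rule seq_closedD[OF Cl(1)])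
        fix n
        \<comment> \<open>Level 2n is taken since the first n entries of both components in
          \<open>Cl\<close> use entries of \<open>y\<close> up to 2n - 1.\<close>
        obtain a' b' y k where in': "inCl a' b' y" and pre: "pre a (2 * n) = pre a' k" "pre b (2 * n) = pre b' k" "pre z (2 * n) = pre y k"
          using z[of "2 * n"] unfolding T0_def by blast
        have "k = 2 * n" using arg_cong[OF pre(1), of length] by simp
        then have agree: "a i = a' i" "b i = b' i" "z i = y i" if "i < 2 * n" for i
          using pre[unfolded \<open>k = 2 * n\<close> pre_eq_iff] that by blast+
        have "interleave3 a' b' (\<lambda>i. y (2 * i)) i = interleave3 a b (\<lambda>i. z (2 * i)) i \<and> y (2 * i + 1) = z (2 * i + 1)" if "i < n" for i
        proof -
          have "i div 3 < 2 * n" "2 * (i div 3) < 2 * n" "2 * i + 1 < 2 * n" using that by auto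
          then show ?thesis unfolding interleave3_def using agree by simp
        qed
        then show "\<exists>w' z'. (w', z') \<in> Cl \<and> (\<forall>i<n. w' i = interleave3 a b (\<lambda>i. z (2 * i)) i \<and> z' i = z (2 * i + 1))"
          using in' unfolding inCl_def by blast
      qed
      then show "Q a b" unfolding Q Cl(2) by force
    qed
    show "T0 (take n u) (take n v) (take n s)" if T: "T0 u v s" for u v s n
    proof -
      obtain a b y k where "inCl a b y" "u = pre a k" "v = pre b k" "s = pre y k"
        using T unfolding T0_def by blast
      then have "inCl a b y \<and> take n u = pre a (min n k) \<and> take n v = pre b (min n k) \<and> take n s = pre y (min n k)"
        by (simp add: take_pre)
      then show ?thesis unfolding T0_def by blast
    qed
    show "length u = length s \<and> length v = length s" if "T0 u v s" for u v s
      using that unfolding T0_def by auto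
    show "u ! i \<le> 1" if T: "T0 u v s" and i: "i < length u" for u v s i
    proof -
      obtain a b y n where ab: "inCl a b y" "u = pre a n" using T unfolding T0_def by blast
      then have "interleave3 a b (\<lambda>i. y (2 * i)) \<in> C'" unfolding inCl_def Cl(2) by force
      then have "a i \<le> 1" unfolding in_C' using f_le by blast
      then show ?thesis using ab(2) i by simp
    qed
    show "Q a c" if ab: "Q a b" and bc: "Q b c" for a b c
    proof -
      obtain x y where xy: "(x, y) \<in> R" "a = f x" "b = f y" using ab unfolding Q_def by blast
      obtain y' z where yz: "(y', z) \<in> R" "b = f y'" "c = f z" using bc unfolding Q_def by blast
      have "y = y'" using inj xy yz RX by (auto dest: inj_onD)
      then show ?thesis using xy yz trans unfolding Q_def by (blast dest: transD)
    qed
  qed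
  then have "tree_relation (\<lambda>a b. \<exists>x y. (x, y) \<in> R \<and> a = f x \<and> b = f y) T0"
    unfolding Q_def .
  with meas inj show thesis by (rule that)
qed

section \<open>The Borel reduction\<close>

lemma pre_measurable:
  assumes "\<And>i. (\<lambda>x. f x i) \<in> measurable X (count_space UNIV)"
  shows "{x \<in> space X. P (pre (f x) n)} \<in> sets X"
proof (induction n arbitrary: P)
  case (Suc n)
  have "{x \<in> space X. f x n = k \<and> P (pre (f x) n @ [k])} \<in> sets X" for k
  proof -
    have a: "{x \<in> space X. f x n = k} \<in> sets X"
      using measurable_sets[OF assms, of "{k}" n] by (simp add: vimage_def Int_def conj_commute)
    show ?thesis using sets.sets_Collect_conj[OF Suc[of "\<lambda>l. P (l @ [k])"] a] .
  qed
  then have "{x \<in> space X. \<exists>k. f x n = k \<and> P (pre (f x) n @ [k])} \<in> sets X"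
    by (intro sets.sets_Collect_countable_Ex)
  then show ?case by simp
qed (simp add: sets.sets_Collect_const)

theorem (in universal_group) embeddability_complete:
  fixes X :: "'x measure"
  assumes R: "Sigma11_quasi_order X R"
  shows "borel_reduces X R (Subg_space D d) (isometric_embeddability D d)"
proof (cases "space X = {}")
  case True
  \<comment> \<open>Over an empty space the value is arbitrary: the empty set is not a subgroup, but
    it is never attained.\<close>
  then have "(\<lambda>_. {}) \<in> measurable X (Subg_space D d)" by (auto intro!: measurableI)
  then show ?thesis unfolding borel_reduces_def using True by blast
next
  case False
  obtain f :: "'x \<Rightarrow> nat \<Rightarrow> nat" and T0
    where meas: "\<And>i. (\<lambda>x. f x i) \<in> measurable X (count_space UNIV)" and inj: "inj_on f (space X)"
    and tree: "tree_relation (\<lambda>a b. \<exists>x y. (x, y) \<in> R \<and> a = f x \<and> b = f y) T0"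
    using Sigma11_quasi_order_code[OF R False] by blast
  define Q where "Q = (\<lambda>a b. \<exists>x y. (x, y) \<in> R \<and> a = f x \<and> b = f y)"
  interpret tree_relation Q T0 unfolding Q_def by (rule tree)
  have RX: "R \<subseteq> space X \<times> space X" and refl: "refl_on (space X) R"
    using R unfolding Sigma11_quasi_order_def preorder_on_def by auto
  obtain \<phi> where "boolean_copy K D d \<phi> vcolour vedge" by (rule boolean_copy_exists)
  then interpret boolean_copy K D d \<phi> vcolour vedge .
  have "(\<lambda>x. subgr (vertices (f x))) \<in> measurable X (Subg_space D d)"
  proof (rule subgr_measurable)
    show "{x \<in> space X. v \<in> vertices (f x)} \<in> sets X" for v
    \<comment> \<open>Nodes are always present, and a tag depends on finitely many entries of
      \<open>f x\<close>.\<close>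
    proof (cases v)
      case (Tag u s)
      then have "{x \<in> space X. v \<in> vertices (f x)} = {x \<in> space X. s \<noteq> [] \<and> T u (pre (f x) (length s - 1)) s}"
        unfolding vertices_def by auto
      then show ?thesis using pre_measurable[OF meas, where P = "\<lambda>l. s \<noteq> [] \<and> T u l s" and n = "length s - 1"] by simp
    qed (simp add: vertices_def)
  qed
  moreover have "\<forall>x\<in>space X. \<forall>y\<in>space X. (x, y) \<in> R \<longleftrightarrow> (subgr (vertices (f x)), subgr (vertices (f y))) \<in> isometric_embeddability D d"
  proof (intro ballI iffI)
    fix x y assume "(x, y) \<in> R"
    then have "Q (f x) (f y)" unfolding Q_def by blast
    then obtain g where g: "inj g" "g ` vertices (f x) \<subseteq> vertices (f y)" "\<And>v. vcolour (g v) = vcolour v"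
      "\<And>v w. vedge (g v) (g w) \<longleftrightarrow> vedge v w"
      using Q_imp_vertex_map by blast
    show "(subgr (vertices (f x)), subgr (vertices (f y))) \<in> isometric_embeddability D d"
      by (rule embeddable_if_graph_embedding[OF inj_on_subset[OF g(1) subset_UNIV] g(2)]) (rule g)+
  next
    fix x y assume x: "x \<in> space X" and y: "y \<in> space X"
    assume "(subgr (vertices (f x)), subgr (vertices (f y))) \<in> isometric_embeddability D d"
    then obtain g where g: "g ` vertices (f x) \<subseteq> vertices (f y)" "\<And>v. v \<in> vertices (f x) \<Longrightarrow> vcolour (g v) = vcolour v"
      "\<And>v w. v \<in> vertices (f x) \<Longrightarrow> w \<in> vertices (f x) \<Longrightarrow> v \<noteq> w \<Longrightarrow> vedge v w \<Longrightarrow> vedge (g v) (g w) \<or> vedge (g w) (g v)"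
      by (rule graph_map_if_embeddable) blast
    \<comment> \<open>The graph map cannot tell equality of codes from \<open>Q\<close>; the former
      is absorbed by injectivity of \<open>f\<close> and reflexivity of \<open>R\<close>.\<close>
    have "f x = f y \<or> Q (f x) (f y)"
      by (rule vertex_map_imp_Q[OF g(1)]) (use g(2,3) vedge_irrefl in blast)+
    then show "(x, y) \<in> R"
    proof
      assume "f x = f y"
      then show ?thesis using inj x y refl by (metis inj_onD refl_onD)
    next
      assume "Q (f x) (f y)"
      then obtain x' y' where "(x', y') \<in> R" "f x = f x'" "f y = f y'" unfolding Q_def by blast
      moreover from this have "x' \<in> space X" "y' \<in> space X" using RX by auto
      ultimately show ?thesis using inj x y by (metis inj_onD)
    qed
  qed
  ultimately show ?thesis unfolding borel_reduces_def by (intro bexI[of _ "\<lambda>x. subgr (vertices (f x))"])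
qed

theorem theorem4p6:
  fixes K :: real and D :: "'g monoid" and d :: "'g \<Rightarrow> 'g \<Rightarrow> real"
  assumes "K > 0" and "universal_bounded_polish_metric_group K D d"
  shows "Sigma11_quasi_order (Subg_space D d) (isometric_embeddability D d) \<and>
    (\<forall>(X :: 'x measure) R. Sigma11_quasi_order X R \<longrightarrow>
       borel_reduces X R (Subg_space D d) (isometric_embeddability D d))"
proof -
  interpret universal_group K D d
    by unfold_locales (use assms universal_bounded_polish_metric_group_def in auto)
  show ?thesis using Sigma11_embeddability embeddability_complete by blast
qed

end
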